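(* There is an algorithm running in time $2^{2^{\mathrm{poly}(n)}}$ ($n$ the bit length of the input; i.e. a $\mathsf{2\text{-}EXPTIME}$ algorithm) which decides, given any $x, y \in \mathbb{Z}$ and any finite set $F$ of functions $f_i(z) = a_i z + b_i$ with $a_i, b_i \in \mathbb{Z}$, whether $x \xrightarrow{F} y$. In particular, affine reachability over $\mathbb{Z}$ (in dimension one) is decidable.
   Context: For a set $S$ of affine functions $\mathbb{Z}\to\mathbb{Z}$, an $S$-composition is a finite tuple $(s_1,\dots,s_K)$ with $K \ge 0$ and each $s_i \in S$, identified with the function $s_K \circ \dots \circ s_1$ (the empty tuple being the identity). We write $x \xrightarrow{S} y$ if there exists an $S$-composition $G$ with $G(x) = y$. *)

theory Defs
  imports Main
begin

definition aff :: "int \<times> int \<Rightarrow> int \<Rightarrow> int" where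
  "aff p z = fst p * z + snd p"

definition comp_apply :: "(int \<times> int) list \<Rightarrow> int \<Rightarrow> int" where
  "comp_apply gs x = fold aff gs x"

definition reach :: "(int \<times> int) set \<Rightarrow> int \<Rightarrow> int \<Rightarrow> bool" where
  "reach S x y \<longleftrightarrow> (\<exists>gs. set gs \<subseteq> S \<and> comp_apply gs x = y)"

fun enc_nat :: "nat \<Rightarrow> bool list" where
  "enc_nat 0 = []"
| "enc_nat (Suc n) = odd (Suc n) # enc_nat (Suc n div 2)"

text \<open>Self-delimiting encoding: every bit b becomes [True, b], terminated by False.\<close>
definition sd :: "bool list \<Rightarrow> bool list" where
  "sd bs = concat (map (\<lambda>b. [True, b]) bs) @ [False]"

definition enc_int :: "int \<Rightarrow> bool list" where
  "enc_int z = (z < 0) # sd (enc_nat (nat \<bar>z\<bar>))"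

definition enc_inst :: "int \<Rightarrow> int \<Rightarrow> (int \<times> int) list \<Rightarrow> bool list" where
  "enc_inst x y fs = enc_int x @ enc_int y @ concat (map (\<lambda>(a,b). enc_int a @ enc_int b) fs)"

datatype dir = Lft | Rgt | Stay

text \<open>States 0..<nstates (start state 0), tape symbols 0..<nsyms
  (0 = blank, 1 = bit False, 2 = bit True).\<close>
record tm =
  nstates :: nat
  nsyms :: nat
  delta :: "nat \<Rightarrow> nat \<Rightarrow> nat \<times> nat \<times> dir"
  acc :: nat
  rej :: nat

definition wf_tm :: "tm \<Rightarrow> bool" where
  "wf_tm M \<longleftrightarrow> 3 \<le> nsyms M \<and> acc M < nstates M \<and> rej M < nstates M \<and> acc M \<noteq> rej M
     \<and> (\<forall>q < nstates M. \<forall>s < nsyms M.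
          fst (delta M q s) < nstates M \<and> fst (snd (delta M q s)) < nsyms M)"

type_synonym config = "nat \<times> (int \<Rightarrow> nat) \<times> int"

definition move :: "dir \<Rightarrow> int \<Rightarrow> int" where
  "move d h = (case d of Lft \<Rightarrow> h - 1 | Rgt \<Rightarrow> h + 1 | Stay \<Rightarrow> h)"

definition step :: "tm \<Rightarrow> config \<Rightarrow> config" where
  "step M c = (case c of (q, tp, h) \<Rightarrow>
     if q = acc M \<or> q = rej M then c
     else (case delta M q (tp h) of (q', s', d) \<Rightarrow> (q', tp(h := s'), move d h)))"

definition init_config :: "bool list \<Rightarrow> config" where
  "init_config w = (0, (\<lambda>i. if 0 \<le> i \<and> i < int (length w)
                          then (if w ! nat i then 2 else 1) else 0), 0)"

definition run :: "tm \<Rightarrow> bool list \<Rightarrow> nat \<Rightarrow> config" where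
  "run M w t = (step M ^^ t) (init_config w)"

definition answers_within :: "tm \<Rightarrow> bool list \<Rightarrow> nat \<Rightarrow> bool \<Rightarrow> bool" where
  "answers_within M w T b \<longleftrightarrow>
     (\<exists>t \<le> T. fst (run M w t) = (if b then acc M else rej M))"

end

(* A value of absolute value above H, a bound for all inputs, keeps its sign under a map a z + b
   up to the sign of a, and only its residue modulo a suitable c matters: c is the length of a
   translation towards 0 that is available as a word of at most three maps.  So the part of a
   path that makes a long excursion and comes back can be replaced by a word of length O(H^2),
   obtained by shortening in the finite graph of signs and residues, followed by translations by c.
   Such a c exists unless there is at most one reflection and no proper translation, and then no
   excursion comes back.  Hence a path can be taken inside a window of doubly exponential size.
   A Turing machine saturates the set of reachable values of that window, one tape cell per value. *)
theory Submission
  imports Defs "HOL-Library.Nat_Bijection"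
begin

section \<open>Paths in a bounded window\<close>

text \<open>The obstacle is that neither the height nor the length of an excursion is bounded in
  advance, so its word cannot be kept, only its endpoints. Its last map \<open>f\<close> is the key:
  to bring a value \<open>u\<close> from beyond \<open>H\<close> back to at most \<open>H\<close>,
  it must have slope 0, 1 or -1. With slope 0 the whole excursion collapses to the single step
  \<open>f\<close>. Otherwise |u| \<le> 2H, and the modulus c comes from \<open>f\<close>: a
  translation points towards 0 by itself, a reflection needs a partner in \<open>F\<close>. There
  are two thresholds: an excursion starts beyond \<open>K\<close> and ends at \<open>H\<close>. A
  map of nonzero slope lowers an absolute value by at most \<open>H\<close>, so a word of at most
  \<open>L\<close> maps started beyond \<open>K\<close> = HL + 3H ends at some v beyond 3H. Then u
  lies between v and 0 and is hit by translations by c. The same 3H is what makes a return with a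
  lone reflection impossible. Each map multiplies |z| + 1 by at most 2H. With coefficients up to H =
  2^n and words of length O(H^2), this gives values that are doubly exponential in n, and no better
  bound is sought. The machine is polynomial in the window size, so only the degree of that
  polynomial has to be independent of the input.\<close>

definition win :: "(int \<times> int) set \<Rightarrow> int \<Rightarrow> (int \<times> int) set" where
  "win F W = {(z, z'). \<exists>p\<in>F. z' = aff p z \<and> \<bar>z\<bar> < W \<and> \<bar>z'\<bar> < W}"

lemma reach_refl: "reach F x x"
  unfolding reach_def comp_apply_def by (rule exI[of _ "[]"]) simp

lemma reach_step:
  assumes "reach F x y" "p \<in> F" shows "reach F x (aff p y)"
proof -
  obtain gs where "set gs \<subseteq> F" "fold aff gs x = y" using assms(1) by (auto simp: reach_def comp_apply_def)
  then show ?thesis unfolding reach_def comp_apply_def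
    using assms(2) by (intro exI[of _ "gs @ [p]"]) auto
qed


text \<open>$16 h^2$ bounds the number of edges of the graph of signs and residues modulo $|c| \<le> 2h$,
  and a word of that length started beyond $h(16 h^2 + 3)$ stays beyond $2h$.\<close>
locale bounded_coeffs =
  fixes F :: "(int \<times> int) set" and h :: nat and W :: int
  assumes h: "1 \<le> h"
    and coeffs: "\<And>p. p \<in> F \<Longrightarrow> \<bar>fst p\<bar> \<le> int h \<and> \<bar>snd p\<bar> \<le> int h"
    and W: "(2 * int h) ^ (16 * h\<^sup>2 + 1) * (int h * (16 * int h ^ 2 + 3) + 1) + 3 * int h < W"
begin

abbreviation "H \<equiv> int h"
abbreviation "L \<equiv> 16 * h\<^sup>2"
abbreviation "K \<equiv> H * (16 * H\<^sup>2 + 3)"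

text \<open>The summand 1 absorbs the constant term, which makes the bound multiplicative, so that
  it iterates to a factor \<open>(2 * H) ^ k\<close>.\<close>

lemma aff_upper: "p \<in> F \<Longrightarrow> \<bar>aff p z\<bar> + 1 \<le> 2 * H * (\<bar>z\<bar> + 1)"
proof -
  assume p: "p \<in> F"
  have "\<bar>aff p z\<bar> \<le> \<bar>fst p\<bar> * \<bar>z\<bar> + \<bar>snd p\<bar>"
    unfolding aff_def by (metis abs_mult abs_triangle_ineq)
  also have "\<dots> \<le> H * \<bar>z\<bar> + H" using coeffs[OF p] by (intro add_mono mult_right_mono) auto
  finally have "\<bar>aff p z\<bar> + 1 \<le> H * \<bar>z\<bar> + 2 * H" using h by linarith
  moreover have "0 \<le> H * \<bar>z\<bar>" by simp
  moreover have "2 * H * (\<bar>z\<bar> + 1) = 2 * (H * \<bar>z\<bar>) + 2 * H" by (simp add: algebra_simps)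
  ultimately show ?thesis by linarith
qed

lemma aff_lower:
  assumes "p \<in> F" "fst p \<noteq> 0" shows "\<bar>z\<bar> - H \<le> \<bar>aff p z\<bar>"
proof -
  have "1 * \<bar>z\<bar> \<le> \<bar>fst p\<bar> * \<bar>z\<bar>" using assms(2) by (intro mult_right_mono) auto
  then have "\<bar>z\<bar> \<le> \<bar>fst p * z\<bar>" by (simp add: abs_mult)
  then show ?thesis using coeffs[OF assms(1)] unfolding aff_def by linarith
qed

lemma aff_lower2:
  assumes "p \<in> F" "2 \<le> \<bar>fst p\<bar>" shows "2 * \<bar>z\<bar> - H \<le> \<bar>aff p z\<bar>"
proof -
  have "2 * \<bar>z\<bar> \<le> \<bar>fst p\<bar> * \<bar>z\<bar>" using assms(2) by (intro mult_right_mono) auto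
  then have "2 * \<bar>z\<bar> \<le> \<bar>fst p * z\<bar>" by (simp add: abs_mult)
  then show ?thesis using coeffs[OF assms(1)] unfolding aff_def by linarith
qed

lemma sgn_aff:
  assumes "p \<in> F" "fst p \<noteq> 0" "H < \<bar>z\<bar>" shows "sgn (aff p z) = sgn (fst p) * sgn z"
proof -
  have "1 * \<bar>z\<bar> \<le> \<bar>fst p\<bar> * \<bar>z\<bar>" using assms(2) by (intro mult_right_mono) auto
  then have "\<bar>z\<bar> \<le> \<bar>fst p * z\<bar>" by (simp add: abs_mult)
  then have "\<bar>snd p\<bar> < \<bar>fst p * z\<bar>" using coeffs[OF assms(1)] assms(3) by linarith
  then have "sgn (aff p z) = sgn (fst p * z)" unfolding aff_def by (auto simp: sgn_if)
  then show ?thesis by (simp add: sgn_mult)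
qed

section \<open>The finite graph of signs and residues\<close>

definition outside :: "(int \<times> int) set" where
  "outside = {(z, z'). H < \<bar>z\<bar> \<and> H < \<bar>z'\<bar> \<and> (\<exists>p\<in>F. fst p \<noteq> 0 \<and> z' = aff p z)}"

text \<open>Far from the origin only the sign and the residue modulo \<^term>\<open>c\<close> of a value matter.\<close>
definition far :: "int \<Rightarrow> ((int \<times> int) \<times> (int \<times> int)) set" where
  "far c = {((\<sigma>, r), (\<sigma>', r')). \<sigma> \<in> {- 1, 1} \<and> \<sigma>' \<in> {- 1, 1} \<and> r \<in> {0..<c} \<and> r' \<in> {0..<c}
     \<and> (\<exists>p\<in>F. fst p \<noteq> 0 \<and> \<sigma>' = sgn (fst p) * \<sigma> \<and> r' = aff p r mod c)}"

definition sign_res :: "int \<Rightarrow> int \<Rightarrow> int \<times> int" where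
  "sign_res c z = (sgn z, z mod c)"

lemma far_subset: "far c \<subseteq> ({- 1, 1} \<times> {0..<c}) \<times> ({- 1, 1} \<times> {0..<c})"
  unfolding far_def by auto

lemma finite_far: "finite (far c)"
  by (rule finite_subset[OF far_subset]) auto

lemma card_far: "card (far c) \<le> 4 * nat c ^ 2"
proof -
  have "card (far c) \<le> card (({- 1, 1 :: int} \<times> {0..<c}) \<times> ({- 1, 1 :: int} \<times> {0..<c}))"
    by (rule card_mono[OF _ far_subset]) auto
  also have "\<dots> = 4 * nat c ^ 2" by (simp add: card_cartesian_product power2_eq_square algebra_simps)
  finally show ?thesis .
qed

lemma aff_mod: "aff p (z mod c) mod c = aff p z mod c"
  unfolding aff_def by (metis mod_add_left_eq mod_mult_right_eq)

lemma outside_far: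
  assumes "(z, z') \<in> outside" "0 < c" shows "(sign_res c z, sign_res c z') \<in> far c"
proof -
  obtain p where p: "p \<in> F" "fst p \<noteq> 0" "z' = aff p z" "H < \<bar>z\<bar>" "H < \<bar>z'\<bar>"
    using assms by (auto simp: outside_def)
  have "z \<noteq> 0" "z' \<noteq> 0" using p by auto
  then show ?thesis using p assms(2) sgn_aff[OF p(1,2,4)]
    by (auto simp: far_def sign_res_def aff_mod sgn_if intro!: bexI[OF _ p(1)])
qed

lemma outside_far_rtrancl:
  assumes "(z, z') \<in> outside\<^sup>*" "0 < c" shows "(sign_res c z, sign_res c z') \<in> (far c)\<^sup>*"
  using assms(1) by induction (auto intro: rtrancl_into_rtrancl outside_far[OF _ assms(2)])

lemma winI: "p \<in> F \<Longrightarrow> \<bar>z\<bar> < W \<Longrightarrow> \<bar>aff p z\<bar> < W \<Longrightarrow> (z, aff p z) \<in> win F W"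
  unfolding win_def by auto

text \<open>Every edge is realised by the map that witnesses it. Each map costs at most
  \<open>H\<close> in absolute value, so a start beyond \<open>H * (int k + 1)\<close> keeps every
  value to which a map is applied beyond \<open>H\<close>, where \<open>sgn_aff\<close> holds; the
  growth bound keeps the path in the window.\<close>

lemma far_lift:
  assumes "(sign_res c z, q) \<in> far c ^^ k" "H * (int k + 1) < \<bar>z\<bar>" "(2 * H) ^ k * (\<bar>z\<bar> + 1) \<le> W"
  shows "\<exists>v. (z, v) \<in> (win F W)\<^sup>* \<and> sign_res c v = q \<and> \<bar>z\<bar> - H * int k \<le> \<bar>v\<bar>
    \<and> \<bar>v\<bar> + 1 \<le> (2 * H) ^ k * (\<bar>z\<bar> + 1)"
  using assms
proof (induction k arbitrary: z)
  case 0
  then show ?case by (intro exI[of _ z]) auto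
next
  case (Suc k)
  obtain q1 where q1: "(sign_res c z, q1) \<in> far c" "(q1, q) \<in> far c ^^ k"
    using Suc.prems(1) by (meson relpow_Suc_D2)
  then obtain p where p: "p \<in> F" "fst p \<noteq> 0" "q1 = (sgn (fst p) * sgn z, aff p (z mod c) mod c)"
    unfolding far_def sign_res_def by auto
  have "H * 1 \<le> H * (int (Suc k) + 1)" using h by (intro mult_left_mono) auto
  then have zH: "H < \<bar>z\<bar>" using Suc.prems(2) by simp
  have q1': "q1 = sign_res c (aff p z)" using sgn_aff[OF p(1,2) zH] by (simp add: p(3) sign_res_def aff_mod)
  have lo: "\<bar>z\<bar> - H \<le> \<bar>aff p z\<bar>" by (rule aff_lower) (use p in auto)
  have up: "\<bar>aff p z\<bar> + 1 \<le> 2 * H * (\<bar>z\<bar> + 1)" by (rule aff_upper) (use p in auto)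
  have pos: "1 \<le> (2 * H) ^ k" using h by (intro one_le_power) auto
  define X Y where "X = (2 * H) ^ k * (\<bar>aff p z\<bar> + 1)" and "Y = (2 * H) ^ Suc k * (\<bar>z\<bar> + 1)"
  have YW: "Y \<le> W" using Suc.prems(3) by (simp only: Y_def)
  have XY: "X \<le> Y"
    using mult_left_mono[OF up, of "(2 * H) ^ k"] pos by (simp add: X_def Y_def algebra_simps)
  have "1 * (\<bar>aff p z\<bar> + 1) \<le> X" unfolding X_def using pos by (intro mult_right_mono) auto
  then have w1: "\<bar>aff p z\<bar> < W" using XY YW unfolding mult_1 by linarith
  have "1 \<le> (2 * H) ^ Suc k" using h by (intro one_le_power) auto
  then have "1 * (\<bar>z\<bar> + 1) \<le> Y" unfolding Y_def by (intro mult_right_mono) auto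
  then have w2: "\<bar>z\<bar> < W" using YW unfolding mult_1 by linarith
  have "\<exists>v. (aff p z, v) \<in> (win F W)\<^sup>* \<and> sign_res c v = q \<and> \<bar>aff p z\<bar> - H * int k \<le> \<bar>v\<bar>
    \<and> \<bar>v\<bar> + 1 \<le> (2 * H) ^ k * (\<bar>aff p z\<bar> + 1)"
  proof (rule Suc.IH)
    show "(sign_res c (aff p z), q) \<in> far c ^^ k" using q1(2) q1' by simp
    show "H * (int k + 1) < \<bar>aff p z\<bar>" using Suc.prems(2) lo by (simp add: algebra_simps)
    show "(2 * H) ^ k * (\<bar>aff p z\<bar> + 1) \<le> W" using order.trans[OF XY YW] by (simp only: X_def)
  qed
  then obtain v where v: "(aff p z, v) \<in> (win F W)\<^sup>*" "sign_res c v = q" "\<bar>aff p z\<bar> - H * int k \<le> \<bar>v\<bar>"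
    "\<bar>v\<bar> + 1 \<le> X" unfolding X_def by blast
  have "(z, v) \<in> (win F W)\<^sup>*"
    by (rule converse_rtrancl_into_rtrancl[OF winI[OF p(1) w2 w1] v(1)])
  moreover have "\<bar>z\<bar> - H * int (Suc k) \<le> \<bar>v\<bar>" using v(3) lo by (simp add: algebra_simps)
  moreover have "\<bar>v\<bar> + 1 \<le> (2 * H) ^ Suc k * (\<bar>z\<bar> + 1)"
    using order.trans[OF v(4) XY] by (simp only: Y_def)
  ultimately show ?case using v(2) by blast
qed

text \<open>Splits a word at its first return: \<open>u\<close> is the last value before it and
  \<open>f\<close> the map that returns. The strict decrease of the length of \<open>rest\<close>
  drives the induction in \<open>fold_win\<close>.\<close>

lemma leave_outside:
  assumes "set gs \<subseteq> F" "H < \<bar>x\<bar>" "\<bar>fold aff gs x\<bar> \<le> H"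
  shows "\<exists>u f rest. (x, u) \<in> outside\<^sup>* \<and> H < \<bar>u\<bar> \<and> f \<in> F \<and> \<bar>aff f u\<bar> \<le> H \<and> set rest \<subseteq> F
    \<and> length rest < length gs \<and> fold aff rest (aff f u) = fold aff gs x"
  using assms
proof (induction gs arbitrary: x)
  case (Cons p gs)
  show ?case
  proof (cases "\<bar>aff p x\<bar> \<le> H")
    case True
    then show ?thesis using Cons.prems
      by (intro exI[of _ x] exI[of _ p] exI[of _ gs]) auto
  next
    case False
    \<comment> \<open>A map of slope 0 has a value of absolute value at most \<open>H\<close>, which
      \<open>False\<close> excludes.\<close>
    have "fst p \<noteq> 0" using False coeffs[of p] Cons.prems(1) by (auto simp: aff_def)
    then have "(x, aff p x) \<in> outside" using False Cons.prems by (auto simp: outside_def)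
    moreover from Cons.IH[of "aff p x"] False Cons.prems obtain u f rest where
      "(aff p x, u) \<in> outside\<^sup>*" "H < \<bar>u\<bar>" "f \<in> F" "\<bar>aff f u\<bar> \<le> H" "set rest \<subseteq> F"
      "length rest < length gs" "fold aff rest (aff f u) = fold aff gs (aff p x)" by auto
    ultimately show ?thesis
      by (intro exI[of _ u] exI[of _ f] exI[of _ rest]) (auto intro: converse_rtrancl_into_rtrancl)
  qed
qed auto

section \<open>Translations available inside the window\<close>

text \<open>The margin \<open>3 * H\<close> leaves room for the intermediate values of a word of up
  to three maps.\<close>

definition slide :: "int \<Rightarrow> bool" where
  "slide c \<longleftrightarrow> c \<noteq> 0 \<and> \<bar>c\<bar> \<le> 2 * H \<and> (\<forall>z. \<bar>z\<bar> + 3 * H < W \<longrightarrow> (z, z + c) \<in> (win F W)\<^sup>*)"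

lemma slide_translation:
  assumes "(1, b) \<in> F" "b \<noteq> 0" shows "slide b"
  unfolding slide_def
proof (intro conjI allI impI)
  have b: "\<bar>b\<bar> \<le> H" using coeffs[OF assms(1)] by simp
  then show "\<bar>b\<bar> \<le> 2 * H" by linarith
  fix z assume "\<bar>z\<bar> + 3 * H < W"
  then have "(z, aff (1, b) z) \<in> win F W"
    using b by (intro winI[OF assms(1)]) (auto simp: aff_def)
  then show "(z, z + b) \<in> (win F W)\<^sup>*" by (simp add: aff_def)
qed (rule assms)

text \<open>Two distinct reflections compose to a proper translation; exchanging them gives the
  opposite one.\<close>

lemma slide_reflections:
  assumes "(-1, b) \<in> F" "(-1, b') \<in> F" "b \<noteq> b'" shows "slide (b' - b)"
  unfolding slide_def
proof (intro conjI allI impI)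
  have b: "\<bar>b\<bar> \<le> H" "\<bar>b'\<bar> \<le> H" using coeffs[OF assms(1)] coeffs[OF assms(2)] by simp_all
  then show "\<bar>b' - b\<bar> \<le> 2 * H" by linarith
  show "b' - b \<noteq> 0" using assms by simp
  fix z assume z: "\<bar>z\<bar> + 3 * H < W"
  have "(z, aff (-1, b) z) \<in> win F W"
    using b z by (intro winI[OF assms(1)]) (auto simp: aff_def)
  moreover have "(aff (-1, b) z, aff (-1, b') (aff (-1, b) z)) \<in> win F W"
    using b z by (intro winI[OF assms(2)]) (auto simp: aff_def)
  ultimately show "(z, z + (b' - b)) \<in> (win F W)\<^sup>*"
    by (auto simp: aff_def algebra_simps intro: converse_rtrancl_into_rtrancl)
qed

text \<open>Conjugation by a reflection inverts a translation.\<close>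

lemma slide_reflected_translation:
  assumes "(-1, b) \<in> F" "(1, t) \<in> F" "t \<noteq> 0" shows "slide (- t)"
  unfolding slide_def
proof (intro conjI allI impI)
  have b: "\<bar>b\<bar> \<le> H" "\<bar>t\<bar> \<le> H" using coeffs[OF assms(1)] coeffs[OF assms(2)] by simp_all
  then show "\<bar>- t\<bar> \<le> 2 * H" by linarith
  show "- t \<noteq> 0" using assms by simp
  fix z assume z: "\<bar>z\<bar> + 3 * H < W"
  have "(z, aff (-1, b) z) \<in> win F W"
    using b z by (intro winI[OF assms(1)]) (auto simp: aff_def)
  moreover have "(aff (-1, b) z, aff (1, t) (aff (-1, b) z)) \<in> win F W"
    using b z by (intro winI[OF assms(2)]) (auto simp: aff_def)
  moreover have "(aff (1, t) (aff (-1, b) z), aff (-1, b) (aff (1, t) (aff (-1, b) z))) \<in> win F W"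
    using b z by (intro winI[OF assms(1)]) (auto simp: aff_def)
  ultimately show "(z, z + - t) \<in> (win F W)\<^sup>*"
    by (auto simp: aff_def algebra_simps intro: converse_rtrancl_into_rtrancl)
qed

text \<open>With a single reflection $-z + b$ and no proper translation, $|2z - b|$ cannot decrease.\<close>
lemma single_reflection_no_return:
  assumes refl: "(-1, b) \<in> F" and only: "\<And>b'. (-1, b') \<in> F \<Longrightarrow> b' = b" "\<And>t. (1, t) \<in> F \<Longrightarrow> t = 0"
    and "(z, u) \<in> outside\<^sup>*" "5 * H < \<bar>2 * z - b\<bar>"
  shows "5 * H < \<bar>2 * u - b\<bar>"
  using assms(4)
proof induction
  case base
  show ?case by (rule assms(5))
next
  case (step v v')
  obtain p where p: "p \<in> F" "fst p \<noteq> 0" "v' = aff p v"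
    using step(2) by (auto simp: outside_def)
  obtain a d where ad: "p = (a, d)" by fastforce
  consider "a = 1" | "a = -1" | "2 \<le> \<bar>a\<bar>" using p(2) ad by force
  then show ?case
  proof cases
    case 1
    then have "d = 0" using only(2) p ad by blast
    then show ?thesis using step.IH 1 p ad by (simp add: aff_def)
  next
    case 2
    then have "d = b" using only(1) p ad by blast
    then show ?thesis using step.IH 2 p ad by (simp add: aff_def)
  next
    case 3
    \<comment> \<open>The threshold \<open>5 * H\<close> reproduces itself: the remainder is at most
      |a| H + 3H, and 5 |a| H - |a| H - 3H \<ge> 5H as soon as |a| \<ge> 2, with equality at
      2.\<close>
    have b: "\<bar>b\<bar> \<le> H" "\<bar>d\<bar> \<le> H" using coeffs[OF refl] coeffs[OF p(1)] ad by simp_all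
    have eq: "2 * v' - b = a * (2 * v - b) + (a * b + 2 * d - b)" using p ad by (simp add: aff_def algebra_simps)
    have "\<bar>a * b\<bar> \<le> \<bar>a\<bar> * H" unfolding abs_mult using b by (intro mult_left_mono) auto
    then have 1: "\<bar>a * b + 2 * d - b\<bar> \<le> \<bar>a\<bar> * H + 3 * H" using b by linarith
    have 2: "\<bar>a\<bar> * (5 * H + 1) \<le> \<bar>a * (2 * v - b)\<bar>"
      unfolding abs_mult using step.IH by (intro mult_left_mono) auto
    have 4: "2 * H \<le> \<bar>a\<bar> * H" using 3 by (intro mult_right_mono) auto
    have "\<bar>a\<bar> * (5 * H + 1) = 5 * (\<bar>a\<bar> * H) + \<bar>a\<bar>" by (simp add: algebra_simps)
    then show ?thesis using 1 2 3 4 unfolding eq by linarith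
  qed
qed

text \<open>\<open>u - v\<close> is a multiple of \<open>c\<close>. Since \<open>c\<close> points
  from \<open>v\<close> towards 0 and \<open>u\<close> lies on the way, the factor is nonnegative
  and no intermediate value exceeds |v|, so \<open>c\<close> stays applicable throughout.\<close>

lemma slide_iterate:
  assumes "slide c" "sgn c = - sgn v" "sgn u = sgn v" "u mod \<bar>c\<bar> = v mod \<bar>c\<bar>" "\<bar>u\<bar> \<le> \<bar>v\<bar>" "\<bar>v\<bar> + 3 * H < W"
  shows "(v, u) \<in> (win F W)\<^sup>*"
proof -
  have "\<bar>c\<bar> dvd u - v" using assms(4) by (simp only: mod_eq_dvd_iff)
  then have "c dvd u - v" by simp
  then obtain k where k: "u - v = c * k" by (elim dvdE)
  have v0: "c \<noteq> 0" using assms(1) by (simp add: slide_def)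
  have "0 \<le> k"
  proof (rule ccontr)
    assume "\<not> 0 \<le> k"
    then have "k \<le> -1" by simp
    show False
    proof (cases "0 < c")
      case True
      then have "v < 0" "u < 0" using assms(2,3) by (auto simp: sgn_if split: if_splits)
      moreover have "c * k < 0" using True \<open>k \<le> -1\<close> by (simp add: mult_pos_neg)
      ultimately show False using k assms(5) by linarith
    next
      case False
      then have c: "c < 0" using v0 by simp
      then have "v > 0" "u > 0" using assms(2,3) by (auto simp: sgn_if split: if_splits)
      moreover have "0 < c * k" using c \<open>k \<le> -1\<close> by (simp add: mult_neg_neg)
      ultimately show False using k assms(5) by linarith
    qed
  qed
  then obtain m where m: "k = int m" by (metis nat_0_le)
  then have k: "u - v = c * int m" using k by simp
  have "(v, v + c * int i) \<in> (win F W)\<^sup>*" if "i \<le> m" for i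
    using that
  proof (induction i)
    case (Suc i)
    have "\<bar>v + c * int i\<bar> \<le> \<bar>v\<bar>"
    proof (cases "0 < c")
      case True
      then have "v < 0" "u < 0" using assms(2,3) by (auto simp: sgn_if split: if_splits)
      moreover have "c * int i \<le> c * int m" using Suc.prems True by (intro mult_left_mono) auto
      moreover have "0 \<le> c * int i" using True by simp
      ultimately show ?thesis using k by linarith
    next
      case False
      then have c: "c < 0" using v0 by simp
      then have "v > 0" "u > 0" using assms(2,3) by (auto simp: sgn_if split: if_splits)
      moreover have "c * int m \<le> c * int i" using Suc.prems c by (intro mult_left_mono_neg) auto
      moreover have "c * int i \<le> 0" using c by (simp add: mult_le_0_iff)
      ultimately show ?thesis using k by linarith
    qed
    then have "\<bar>v + c * int i\<bar> + 3 * H < W" using assms(6) by linarith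
    then have "(v + c * int i, v + c * int i + c) \<in> (win F W)\<^sup>*" using assms(1) by (simp add: slide_def)
    from rtrancl_trans[OF Suc.IH this] Suc.prems show ?case by (simp add: distrib_left add.assoc add.commute[of c])
  qed simp
  moreover have "v + c * int m = u" using k by simp
  ultimately show ?thesis by (metis order_refl)
qed

section \<open>Replacing excursions by paths in the window\<close>

lemma W_bounds: "K < W" "2 * H < W"
proof -
  define X where "X = (2 * H) ^ (L + 1) * (K + 1)"
  have XW: "X + 3 * H < W" using W by (simp only: X_def)
  have "1 \<le> (2 * H) ^ (L + 1)" using h by (intro one_le_power) auto
  then have "1 * (K + 1) \<le> X" unfolding X_def by (intro mult_right_mono) auto
  then have "K + 1 \<le> X" by (simp only: mult_1)
  moreover have "0 \<le> K" by simp
  ultimately show "K < W" "2 * H < W" using XW h by linarith+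
qed

text \<open>The maps \<open>p\<close> and \<open>f\<close> are kept. The part from
  \<open>aff p x\<close> to \<open>u\<close> is replaced by a word of at most \<open>L\<close> maps
  to some \<open>v\<close> with the sign and residue of \<open>u\<close>, followed by translations
  from \<open>v\<close> to \<open>u\<close>.\<close>

lemma excursion:
  assumes x: "\<bar>x\<bar> \<le> K" and p: "p \<in> F" and x1: "K < \<bar>aff p x\<bar>"
    and u: "(aff p x, u) \<in> outside\<^sup>*" "H < \<bar>u\<bar>" and f: "f \<in> F" "\<bar>aff f u\<bar> \<le> H"
  shows "(x, aff f u) \<in> (win F W)\<^sup>*"
proof (cases "fst f = 0")
  case True
  \<comment> \<open>A constant map takes the same value at \<open>x\<close>, so one step replaces
    the whole excursion.\<close>
  then have "aff f u = aff f x" by (simp add: aff_def)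
  moreover have "(x, aff f x) \<in> win F W"
    using x f W_bounds calculation by (intro winI) auto
  ultimately show ?thesis by auto
next
  case False
  have K: "K = H * int L + 3 * H" by (simp add: algebra_simps)
  have u2: "\<bar>u\<bar> \<le> 2 * H" using aff_lower[OF f(1) False, of u] f(2) by linarith
  \<comment> \<open>A slope of absolute value at least 2 would give a value above 2H - H, contrary
    to the return.\<close>
  have "\<not> 2 \<le> \<bar>fst f\<bar>" using aff_lower2[OF f(1), of u] f(2) u(2) by linarith
  then have f1: "fst f = 1 \<or> fst f = -1" using False by linarith
  have "\<exists>c. slide c \<and> sgn c = - sgn u"
  proof (cases "fst f = 1")
    case True
    then obtain b where b: "f = (1, b)" by (metis prod.collapse)
    \<comment> \<open>Since |u| > H \<ge> |u + b|, the translation necessarily points from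
      \<open>u\<close> towards 0.\<close>
    then have d: "\<bar>u + b\<bar> \<le> H" using f by (simp add: aff_def)
    then have "sgn b = - sgn u" "b \<noteq> 0" using u(2) by (auto simp: sgn_if)
    then show ?thesis using slide_translation f b by blast
  next
    case False
    then obtain b where b: "f = (-1, b)" using f1 by (metis prod.collapse)
    \<comment> \<open>A partner of the reflection yields translations in both directions, one of
      which points from \<open>u\<close> towards 0.\<close>
    have pm: "\<exists>c. slide c \<and> sgn c = - sgn u" if "slide d" "slide (- d)" for d
    proof -
      have "d \<noteq> 0" using that by (simp add: slide_def)
      then have "sgn d = - sgn u \<or> sgn (- d) = - sgn u" using u(2) by (auto simp: sgn_if)
      then show ?thesis using that by blast
    qed
    consider b' where "(-1, b') \<in> F" "b' \<noteq> b" | t where "(1, t) \<in> F" "t \<noteq> 0"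
      | "\<And>b'. (-1, b') \<in> F \<Longrightarrow> b' = b" "\<And>t. (1, t) \<in> F \<Longrightarrow> t = 0" by blast
    then show ?thesis
    proof cases
      case 1
      then show ?thesis using pm[of "b' - b"] slide_reflections[of b b'] slide_reflections[of b' b] f b by auto
    next
      case 2
      then show ?thesis using pm[of t] slide_translation slide_reflected_translation f b by blast
    next
      case 3
      \<comment> \<open>Contradiction: |2z - b| starts above 2K - H \<ge> 5H and stays above 5H,
        whereas |u| \<le> 2H forces |2u - b| \<le> 5H.\<close>
      have "\<bar>b\<bar> \<le> H" using coeffs[OF f(1)] b by simp
      moreover have "0 \<le> H * int L" by simp
      ultimately have "5 * H < \<bar>2 * aff p x - b\<bar>" using x1 h unfolding K by linarith
      then have "5 * H < \<bar>2 * u - b\<bar>"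
        using single_reflection_no_return[of b, OF _ 3 u(1)] f b by blast
      then show ?thesis using u2 \<open>\<bar>b\<bar> \<le> H\<close> by linarith
    qed
  qed
  then obtain c where c: "slide c" "sgn c = - sgn u" by blast
  then have c0: "0 < \<bar>c\<bar>" "\<bar>c\<bar> \<le> 2 * H" by (auto simp: slide_def)
  \<comment> \<open>The real excursion projects to a walk in \<open>far\<close>, which can be
    shortened to at most as many steps as \<open>far\<close> has edges.\<close>
  obtain k where k: "k \<le> card (far \<bar>c\<bar>)" "(sign_res \<bar>c\<bar> (aff p x), sign_res \<bar>c\<bar> u) \<in> far \<bar>c\<bar> ^^ k"
    using outside_far_rtrancl[OF u(1) c0(1)] rtrancl_finite_eq_relpow[OF finite_far] by auto
  have "nat \<bar>c\<bar> ^ 2 \<le> (2 * h) ^ 2" using c0 by (intro power_mono) auto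
  then have kL: "k \<le> L" using k(1) card_far[of "\<bar>c\<bar>"] by (simp add: power_mult_distrib)
  have "int k \<le> int L" using kL by (simp only: of_nat_le_iff)
  then have Hk: "H * int k \<le> H * int L" by (rule mult_left_mono) simp
  have up: "\<bar>aff p x\<bar> + 1 \<le> 2 * H * (K + 1)"
  proof (rule order.trans[OF aff_upper[OF p]])
    show "2 * H * (\<bar>x\<bar> + 1) \<le> 2 * H * (K + 1)" using x by (intro mult_left_mono) auto
  qed
  define X where "X = (2 * H) ^ k * (\<bar>aff p x\<bar> + 1)"
  have "X \<le> (2 * H) ^ L * (2 * H * (K + 1))"
    unfolding X_def using kL up h by (intro mult_mono power_increasing) auto
  also have "\<dots> = (2 * H) ^ (L + 1) * (K + 1)" by (simp only: power_add power_one_right mult.assoc)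
  finally have big: "X + 3 * H < W" by (rule le_less_trans[OF add_right_mono W])
  have far1: "H * (int k + 1) < \<bar>aff p x\<bar>"
    using Hk x1 unfolding K by (simp add: distrib_left)
  obtain v where v: "(aff p x, v) \<in> (win F W)\<^sup>*" "sign_res \<bar>c\<bar> v = sign_res \<bar>c\<bar> u" "\<bar>aff p x\<bar> - H * int k \<le> \<bar>v\<bar>"
    "\<bar>v\<bar> + 1 \<le> X"
    using far_lift[OF k(2) far1] big unfolding X_def[symmetric] by auto
  have "(x, aff p x) \<in> win F W"
  proof (rule winI[OF p])
    show "\<bar>x\<bar> < W" using x W_bounds by linarith
    have "1 \<le> (2 * H) ^ k" using h by (intro one_le_power) auto
    then have "1 * (\<bar>aff p x\<bar> + 1) \<le> X" unfolding X_def by (intro mult_right_mono) auto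
    then show "\<bar>aff p x\<bar> < W" using big unfolding mult_1 by linarith
  qed
  moreover have "(v, u) \<in> (win F W)\<^sup>*"
  proof (rule slide_iterate[OF c(1)])
    show "sgn c = - sgn v" "sgn u = sgn v" "u mod \<bar>c\<bar> = v mod \<bar>c\<bar>"
      using v(2) c(2) by (auto simp: sign_res_def)
    \<comment> \<open>|v| \<ge> K - HL = 3H, while |u| \<le> 2H.\<close>
    show "\<bar>u\<bar> \<le> \<bar>v\<bar>" using v(3) Hk x1 u2 unfolding K by linarith
    show "\<bar>v\<bar> + 3 * H < W" using v(4) big by linarith
  qed
  moreover have "(u, aff f u) \<in> win F W"
    using f u2 W_bounds by (intro winI) auto
  ultimately show ?thesis using v(1) by (meson converse_rtrancl_into_rtrancl rtrancl.rtrancl_into_rtrancl rtrancl_trans)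
qed

text \<open>A step that stays within \<open>K\<close> is kept; a step beyond \<open>K\<close> opens
  an excursion. The point of return lies within \<open>H\<close>, hence again within
  \<open>K\<close>, and the remaining word is shorter.\<close>

lemma fold_win:
  assumes "set gs \<subseteq> F" "\<bar>x\<bar> \<le> K" "\<bar>fold aff gs x\<bar> \<le> H"
  shows "(x, fold aff gs x) \<in> (win F W)\<^sup>*"
  using assms
proof (induction "length gs" arbitrary: gs x rule: less_induct)
  case less
  have HK: "H \<le> K"
  proof -
    have "H * 1 \<le> K" by (intro mult_left_mono) auto
    then show ?thesis by simp
  qed
  show ?case
  proof (cases gs)
    case (Cons p gs')
    have p: "p \<in> F" "set gs' \<subseteq> F" "fold aff gs x = fold aff gs' (aff p x)" using less.prems Cons by auto
    show ?thesis
    proof (cases "\<bar>aff p x\<bar> \<le> K")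
      case True
      then have "(aff p x, fold aff gs' (aff p x)) \<in> (win F W)\<^sup>*"
        using less.hyps[of gs' "aff p x"] less.prems p Cons by auto
      moreover have "(x, aff p x) \<in> win F W" using True less.prems W_bounds p by (intro winI) auto
      ultimately show ?thesis unfolding p(3) by (rule converse_rtrancl_into_rtrancl[rotated])
    next
      case False
      have "\<bar>fold aff gs' (aff p x)\<bar> \<le> H" using less.prems(3) p(3) by simp
      from leave_outside[OF p(2) _ this] False HK obtain u f rest where
        u: "(aff p x, u) \<in> outside\<^sup>*" "H < \<bar>u\<bar>" "f \<in> F" "\<bar>aff f u\<bar> \<le> H" "set rest \<subseteq> F"
        "length rest < length gs'" "fold aff rest (aff f u) = fold aff gs' (aff p x)"
        by auto
      have "(aff f u, fold aff rest (aff f u)) \<in> (win F W)\<^sup>*"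
        using less.hyps[of rest "aff f u"] u less.prems p HK Cons by auto
      moreover have "(x, aff f u) \<in> (win F W)\<^sup>*"
        using excursion[of x p u f] less.prems p u False by auto
      ultimately show ?thesis unfolding p(3) u(7)[symmetric] by (rule rtrancl_trans[rotated])
    qed
  qed simp
qed

lemma reach_win:
  assumes "reach F x y" "\<bar>x\<bar> \<le> H" "\<bar>y\<bar> \<le> H"
  shows "(x, y) \<in> (win F W)\<^sup>*"
proof -
  obtain gs where gs: "set gs \<subseteq> F" "fold aff gs x = y"
    using assms(1) by (auto simp: reach_def comp_apply_def)
  have "H * 1 \<le> K" by (intro mult_left_mono) auto
  then have "\<bar>x\<bar> \<le> K" using assms(2) by linarith
  from fold_win[OF gs(1) this] gs(2) assms(3) show ?thesis by simp
qed

end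

section \<open>Explicit bounds for the window and for the length of a path\<close>

lemma finite_win: "finite (win F (int m))" and card_win: "card (win F (int m)) \<le> (2 * m) ^ 2"
proof -
  have s: "win F (int m) \<subseteq> {- int m..<int m} \<times> {- int m..<int m}" by (auto simp: win_def)
  show "finite (win F (int m))" by (rule finite_subset[OF s]) auto
  have "card (win F (int m)) \<le> card ({- int m..<int m} \<times> {- int m..<int m})"
    by (rule card_mono[OF _ s]) auto
  also have "\<dots> = (2 * m) ^ 2"
    by (simp add: card_cartesian_product power2_eq_square nat_mult_distrib)
  finally show "card (win F (int m)) \<le> (2 * m) ^ 2" .
qed

lemma win_mono: "W \<le> W' \<Longrightarrow> win F W \<subseteq> win F W'"
  by (auto simp: win_def)

lemma win_relpow_mono:
  assumes "W \<le> W'" shows "win F W ^^ k \<subseteq> win F W' ^^ k"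
proof (induction k)
  case (Suc k)
  then show ?case using win_mono[OF assms, of F] by auto
qed simp

text \<open>The squared term bounds both the half-width of the window and the number of its edges,
  hence the length of a path. The base \<open>2 * h\<close> is 2 ^ (n + 1) with n + 1 \<le> h, so
  the exponent of 2 on the left is of order h ^ 3, and h ^ 8 = 2 ^ (8 * n) dominates it.\<close>

lemma window_size:
  assumes "2 \<le> n" and h: "h = (2::nat) ^ n"
  shows "(2 * ((2 * h) ^ (16 * h\<^sup>2 + 1) * (h * (16 * h\<^sup>2 + 3) + 1) + 3 * h + 1))\<^sup>2 \<le> 2 ^ 2 ^ (8 * n)"
proof -
  define M where "M = (n + 1) * (16 * h\<^sup>2 + 1)"
  have h4: "4 \<le> h" using power_increasing[OF assms(1), of "2::nat"] by (simp add: h)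
  have n: "n + 1 \<le> h" using less_exp[of n] by (simp add: h Suc_le_eq)
  have 1: "(2 * h) ^ (16 * h\<^sup>2 + 1) = 2 ^ M"
    unfolding M_def h by (simp only: power_mult power_add power_one_right flip: power_Suc) (simp add: power_mult)
  have "h * (16 * h\<^sup>2 + 3) + 1 = 16 * h ^ 3 + 3 * h + 1"
    by (simp add: algebra_simps power2_eq_square power3_eq_cube)
  moreover have "h \<le> h ^ 3" "1 \<le> h ^ 3" using h4 by (simp_all add: self_le_power)
  ultimately have 2: "h * (16 * h\<^sup>2 + 3) + 1 \<le> 20 * h ^ 3" "3 * h + 1 \<le> 4 * h ^ 3" by linarith+
  have "2 * ((2 * h) ^ (16 * h\<^sup>2 + 1) * (h * (16 * h\<^sup>2 + 3) + 1) + 3 * h + 1)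
      \<le> 2 * (2 ^ M * (20 * h ^ 3) + 2 ^ M * (4 * h ^ 3))"
  proof -
    have a: "2 ^ M * (h * (16 * h\<^sup>2 + 3) + 1) \<le> 2 ^ M * (20 * h ^ 3)" using 2(1) by (rule mult_le_mono2)
    have b: "3 * h + 1 \<le> 2 ^ M * (4 * h ^ 3)" using 2(2) by (rule order.trans) simp
    show ?thesis unfolding 1 using add_mono[OF a b] by (simp only: add.assoc mult_le_mono2)
  qed
  also have "\<dots> \<le> 2 ^ M * (2 ^ 6 * h ^ 3)" by simp
  also have "\<dots> = 2 ^ (M + (6 + 3 * n))" unfolding h by (simp add: power_add power_mult mult.commute flip: power_mult)
  finally have "(2 * ((2 * h) ^ (16 * h\<^sup>2 + 1) * (h * (16 * h\<^sup>2 + 3) + 1) + 3 * h + 1))\<^sup>2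
      \<le> (2 ^ (M + (6 + 3 * n)))\<^sup>2" by (rule power_mono) simp
  also have "\<dots> = 2 ^ (2 * (M + (6 + 3 * n)))" by (simp add: power_mult mult.commute flip: power_mult)
  also have "\<dots> \<le> 2 ^ 2 ^ (8 * n)"
  proof (rule power_increasing)
    have "M \<le> h * (16 * h\<^sup>2 + 1)" unfolding M_def using n by (rule mult_le_mono1)
    also have "\<dots> = 16 * h ^ 3 + h" by (simp add: algebra_simps power2_eq_square power3_eq_cube)
    finally have "M + (6 + 3 * n) \<le> 16 * h ^ 3 + h + (6 + 3 * h)" using n by (intro add_mono) auto
    then have "2 * (M + (6 + 3 * n)) \<le> 32 * h ^ 3 + 8 * h + 12" by simp
    also have "\<dots> \<le> 64 * h ^ 3" using \<open>h \<le> h ^ 3\<close> h4 by linarith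
    also have "\<dots> = 4 ^ 3 * h ^ 3" by simp
    also have "\<dots> \<le> h ^ 5 * h ^ 3"
    proof (rule mult_le_mono1)
      have "(4::nat) ^ 3 \<le> h ^ 3" using h4 by (intro power_mono) auto
      also have "\<dots> \<le> h ^ 5" using h4 by (intro power_increasing) auto
      finally show "4 ^ 3 \<le> h ^ 5" .
    qed
    also have "\<dots> = 2 ^ (8 * n)" unfolding h by (simp flip: power_mult power_add)
    finally show "2 * (M + (6 + 3 * n)) \<le> 2 ^ (8 * n)" .
  qed simp
  finally show ?thesis .
qed

text \<open>One number serves as half-width and as bound on the number of steps, so the program has
  to compute only one power.\<close>

lemma reach_win_relpow:
  assumes n: "2 \<le> n" and F: "\<And>p. p \<in> F \<Longrightarrow> \<bar>fst p\<bar> \<le> 2 ^ n \<and> \<bar>snd p\<bar> \<le> 2 ^ n"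
    and xy: "\<bar>x\<bar> \<le> 2 ^ n" "\<bar>y\<bar> \<le> 2 ^ n" and "reach F x y"
  shows "\<exists>k \<le> 2 ^ 2 ^ (8 * n). (x, y) \<in> win F (int (2 ^ 2 ^ (8 * n))) ^^ k"
proof -
  define h :: nat where "h = 2 ^ n"
  define m where "m = (2 * h) ^ (16 * h\<^sup>2 + 1) * (h * (16 * h\<^sup>2 + 3) + 1) + 3 * h + 1"
  have m: "(2 * m)\<^sup>2 \<le> 2 ^ 2 ^ (8 * n)" unfolding m_def by (rule window_size[OF n h_def])
  have "int m = (2 * int h) ^ (16 * h\<^sup>2 + 1) * (int h * (16 * int h ^ 2 + 3) + 1) + 3 * int h + 1"
    unfolding m_def by (simp only: of_nat_add of_nat_mult of_nat_power of_nat_numeral of_nat_1)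
  then interpret bounded_coeffs F h "int m"
    using F by unfold_locales (auto simp: h_def)
  have "(x, y) \<in> (win F (int m))\<^sup>*"
    using reach_win assms by (simp add: h_def)
  then obtain k where k: "k \<le> card (win F (int m))" "(x, y) \<in> win F (int m) ^^ k"
    using rtrancl_finite_eq_relpow[OF finite_win] by auto
  have "m \<le> (2 * m)\<^sup>2" by (simp add: power2_eq_square)
  then have "int m \<le> int (2 ^ 2 ^ (8 * n))" using m by linarith
  then have "(x, y) \<in> win F (int (2 ^ 2 ^ (8 * n))) ^^ k"
    using k(2) win_relpow_mono by blast
  moreover have "k \<le> 2 ^ 2 ^ (8 * n)" using k(1) card_win[of F m] m by linarith
  ultimately show ?thesis by blast
qed

section \<open>Structured Turing machine programs\<close>

text \<open>Tracks 0 and 1 carry the input bits, 2 the origin, 3 the array and 4 to 24 the pebbles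
  of the 21 counters.\<close>

definition ntracks :: nat where "ntracks = 32"

text \<open>A tape symbol is the set of tracks marked in a cell, coded by \<open>set_encode\<close>.
  This agrees with the prescribed input alphabet: the empty set is the blank 0, {0} is 1 (bit False)
  and {1} is 2 (bit True).\<close>

datatype tprog =
    Act "nat set \<Rightarrow> nat set" dir
  | TSeq tprog tprog
  | TIf "nat set \<Rightarrow> bool" tprog tprog
  | TWhile "nat set \<Rightarrow> bool" tprog

text \<open>The times are exact step counts of the compiled code: a test costs one step, and so does
  the jump over the second branch of a conditional or back to a loop test.\<close>

inductive texec :: "tprog \<Rightarrow> (int \<Rightarrow> nat set) \<Rightarrow> int \<Rightarrow> nat \<Rightarrow> (int \<Rightarrow> nat set) \<Rightarrow> int \<Rightarrow> bool" where
  texec_Act: "texec (Act f d) T h 1 (T(h := f (T h) \<inter> {..<ntracks})) (move d h)"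
| texec_Seq: "texec c1 T h t1 T' h' \<Longrightarrow> texec c2 T' h' t2 T'' h'' \<Longrightarrow> texec (TSeq c1 c2) T h (t1 + t2) T'' h''"
| texec_IfT: "P (T h) \<Longrightarrow> texec c1 T h t T' h' \<Longrightarrow> texec (TIf P c1 c2) T h (1 + t + 1) T' h'"
| texec_IfF: "\<not> P (T h) \<Longrightarrow> texec c2 T h t T' h' \<Longrightarrow> texec (TIf P c1 c2) T h (1 + t) T' h'"
| texec_WhT: "P (T h) \<Longrightarrow> texec c T h t T' h' \<Longrightarrow> texec (TWhile P c) T' h' t' T'' h''
    \<Longrightarrow> texec (TWhile P c) T h (1 + t + 1 + t') T'' h''"
| texec_WhF: "\<not> P (T h) \<Longrightarrow> texec (TWhile P c) T h 1 T h"

section \<open>Compilation to a Turing machine\<close>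

datatype instr = IAct "nat set \<Rightarrow> nat set" dir | IBr "nat set \<Rightarrow> bool" nat

fun clen :: "tprog \<Rightarrow> nat" where
  "clen (Act f d) = 1"
| "clen (TSeq c1 c2) = clen c1 + clen c2"
| "clen (TIf P c1 c2) = clen c1 + clen c2 + 2"
| "clen (TWhile P c) = clen c + 2"

text \<open>\<^term>\<open>IBr P q\<close> falls through to the next instruction if \<^term>\<open>P\<close> holds, and jumps to
  address \<^term>\<open>q\<close> otherwise; addresses are absolute, the code being placed at \<^term>\<open>b\<close>.\<close>
fun code :: "nat \<Rightarrow> tprog \<Rightarrow> instr list" where
  "code b (Act f d) = [IAct f d]"
| "code b (TSeq c1 c2) = code b c1 @ code (b + clen c1) c2"
| "code b (TIf P c1 c2) = IBr P (b + clen c1 + 2) # code (b + 1) c1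
     @ IBr (\<lambda>_. False) (b + clen c1 + clen c2 + 2) # code (b + clen c1 + 2) c2"
| "code b (TWhile P c) = IBr P (b + clen c + 2) # code (b + 1) c @ [IBr (\<lambda>_. False) b]"

lemma length_code [simp]: "length (code b c) = clen c"
  by (induction c arbitrary: b) auto

text \<open>States are code addresses; the two addresses behind the code accept and reject. The
  minimum on jump targets and the intersection with the tracks make the machine well-formed for
  every instruction list.\<close>

definition machine :: "instr list \<Rightarrow> tm" where
  "machine is = \<lparr>nstates = length is + 2, nsyms = 2 ^ ntracks,
     delta = (\<lambda>q s. if q < length is then
        (case is ! q of
           IAct f d \<Rightarrow> (Suc q, set_encode (f (set_decode s) \<inter> {..<ntracks}), d)
         | IBr P q' \<Rightarrow> (if P (set_decode s) then Suc q else min q' (length is + 1), s, Stay))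
        else (0, 0, Stay)),
     acc = length is, rej = length is + 1\<rparr>"

lemma set_encode_less:
  assumes "A \<subseteq> {..<k}" shows "set_encode A < 2 ^ k"
proof -
  have "set_encode A \<le> (\<Sum>i<k. 2 ^ i)"
    unfolding set_encode_def using assms by (intro sum_mono2) auto
  also have "\<dots> < 2 ^ k"
    by (simp add: lessThan_atLeast0 sum_power2)
  finally show ?thesis .
qed

lemma wf_machine: "wf_tm (machine is)"
proof -
  have "3 \<le> (2::nat) ^ ntracks" by (simp add: ntracks_def)
  then show ?thesis
    by (auto simp: wf_tm_def machine_def set_encode_less split: instr.splits)
qed

abbreviation conf :: "nat \<Rightarrow> (int \<Rightarrow> nat set) \<Rightarrow> int \<Rightarrow> config" where
  "conf q T h \<equiv> (q, \<lambda>i. set_encode (T i), h)"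

lemma step_machine_Act:
  assumes "q < length is" "is ! q = IAct f d" "finite (T h)"
  shows "step (machine is) (conf q T h) = conf (Suc q) (T(h := f (T h) \<inter> {..<ntracks})) (move d h)"
  using assms by (auto simp: step_def machine_def set_encode_inverse fun_eq_iff)

lemma step_machine_Br:
  assumes "q < length is" "is ! q = IBr P q'" "finite (T h)" "q' \<le> length is + 1"
  shows "step (machine is) (conf q T h) = conf (if P (T h) then Suc q else q') T h"
  using assms by (auto simp: step_def machine_def set_encode_inverse fun_eq_iff move_def)

lemma funpow_trans:
  "(f ^^ m) a = b \<Longrightarrow> (f ^^ n) b = c \<Longrightarrow> (f ^^ (m + n)) a = c"
  by (metis add.commute comp_apply funpow_add)

text \<open>Addresses are absolute, hence the generalisation over \<open>pre\<close> and
  \<open>post\<close>: each case regroups the list so that a subprogram again starts at the length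
  of its prefix. The second conjunct keeps cells finite sets, so that decoding inverts
  encoding.\<close>

lemma texec_machine:
  assumes "texec c T h t T' h'" "\<forall>i. T i \<subseteq> {..<ntracks}" "is = pre @ code (length pre) c @ post"
  shows "(step (machine is) ^^ t) (conf (length pre) T h) = conf (length pre + clen c) T' h'
    \<and> (\<forall>i. T' i \<subseteq> {..<ntracks})"
  using assms
proof (induction arbitrary: pre post rule: texec.induct)
  case (texec_Act f d T h)
  then have "finite (T h)" using finite_subset by blast
  moreover have "length pre < length is" "is ! length pre = IAct f d" using texec_Act.prems by simp_all
  ultimately show ?case using texec_Act.prems(1) step_machine_Act[of "length pre" "is" f d T h]
    by (simp add: comp_def)
next
  case (texec_Seq c1 T h t1 T' h' c2 t2 T'' h'')
  have 1: "(step (machine is) ^^ t1) (conf (length pre) T h) = conf (length pre + clen c1) T' h'"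
    "\<forall>i. T' i \<subseteq> {..<ntracks}"
    using texec_Seq.IH(1)[of pre "code (length pre + clen c1) c2 @ post"] texec_Seq.prems by auto
  have 2: "(step (machine is) ^^ t2) (conf (length pre + clen c1) T' h')
      = conf (length pre + clen c1 + clen c2) T'' h''"
    "\<forall>i. T'' i \<subseteq> {..<ntracks}"
    using texec_Seq.IH(2)[of "pre @ code (length pre) c1" post] texec_Seq.prems 1 by auto
  show ?case using funpow_trans[OF 1(1) 2(1)] 2(2) by (simp add: add.assoc)
next
  case (texec_IfT P T h c1 t T' h' c2)
  have fin: "\<And>i. finite (T i)" using texec_IfT.prems finite_subset by blast
  have a: "(step (machine is) ^^ 1) (conf (length pre) T h) = conf (length pre + 1) T h"
    using texec_IfT step_machine_Br[of "length pre" "is" P "length pre + clen c1 + 2" T h] fin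
    by auto
  define q where "q = length pre + 1 + clen c1"
  have 1: "(step (machine is) ^^ t) (conf (length pre + 1) T h) = conf q T' h'"
    "\<forall>i. T' i \<subseteq> {..<ntracks}"
    using texec_IfT.IH[of "pre @ [IBr P (length pre + clen c1 + 2)]"
        "IBr (\<lambda>_. False) (length pre + clen c1 + clen c2 + 2) # code (length pre + clen c1 + 2) c2 @ post"]
      texec_IfT.prems by (auto simp: q_def)
  have fin': "\<And>i. finite (T' i)" using 1 finite_subset by blast
  have "is ! q = IBr (\<lambda>_. False) (length pre + clen c1 + clen c2 + 2)"
    unfolding texec_IfT.prems q_def by (simp add: nth_append nth_Cons')
  then have b: "(step (machine is) ^^ 1) (conf q T' h') = conf (length pre + clen c1 + clen c2 + 2) T' h'"
    using step_machine_Br[of q "is" "\<lambda>_. False" "length pre + clen c1 + clen c2 + 2" T' h'] fin'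
      texec_IfT.prems
    by (auto simp: q_def)
  show ?case using funpow_trans[OF funpow_trans[OF a 1(1)] b] 1(2) by (simp add: add.assoc)
next
  case (texec_IfF P T h c2 t T' h' c1)
  have fin: "\<And>i. finite (T i)" using texec_IfF.prems finite_subset by blast
  have a: "(step (machine is) ^^ 1) (conf (length pre) T h) = conf (length pre + clen c1 + 2) T h"
    using texec_IfF step_machine_Br[of "length pre" "is" P "length pre + clen c1 + 2" T h] fin
    by auto
  have 1: "(step (machine is) ^^ t) (conf (length pre + clen c1 + 2) T h)
      = conf (length pre + clen c1 + 2 + clen c2) T' h'"
    "\<forall>i. T' i \<subseteq> {..<ntracks}"
    using texec_IfF.IH[of "pre @ IBr P (length pre + clen c1 + 2) # code (length pre + 1) c1
        @ [IBr (\<lambda>_. False) (length pre + clen c1 + clen c2 + 2)]" post]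
      texec_IfF.prems by auto
  show ?case using funpow_trans[OF a 1(1)] 1(2) by (simp add: add_ac)
next
  case (texec_WhT P T h c t T' h' t' T'' h'')
  have fin: "\<And>i. finite (T i)" using texec_WhT.prems finite_subset by blast
  have a: "(step (machine is) ^^ 1) (conf (length pre) T h) = conf (length pre + 1) T h"
    using texec_WhT step_machine_Br[of "length pre" "is" P "length pre + clen c + 2" T h] fin
    by auto
  define q where "q = length pre + 1 + clen c"
  have 1: "(step (machine is) ^^ t) (conf (length pre + 1) T h) = conf q T' h'"
    "\<forall>i. T' i \<subseteq> {..<ntracks}"
    using texec_WhT.IH(1)[of "pre @ [IBr P (length pre + clen c + 2)]"
        "IBr (\<lambda>_. False) (length pre) # post"]
      texec_WhT.prems by (auto simp: q_def)
  have fin': "\<And>i. finite (T' i)" using 1 finite_subset by blast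
  have "is ! q = IBr (\<lambda>_. False) (length pre)"
    unfolding texec_WhT.prems q_def by (simp add: nth_append nth_Cons')
  then have b: "(step (machine is) ^^ 1) (conf q T' h') = conf (length pre) T' h'"
    using step_machine_Br[of q "is" "\<lambda>_. False" "length pre" T' h'] fin' texec_WhT.prems
    by (auto simp: q_def)
  show ?case
    using funpow_trans[OF funpow_trans[OF funpow_trans[OF a 1(1)] b]
        conjunct1[OF texec_WhT.IH(2)[OF 1(2) texec_WhT.prems(2)]]]
      texec_WhT.IH(2)[OF 1(2) texec_WhT.prems(2)] by simp
next
  case (texec_WhF P T h c)
  have fin: "\<And>i. finite (T i)" using texec_WhF.prems finite_subset by blast
  show ?case
    using texec_WhF step_machine_Br[of "length pre" "is" P "length pre + clen c + 2" T h] fin by auto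
qed

definition init_tape :: "bool list \<Rightarrow> int \<Rightarrow> nat set" where
  "init_tape w i = (if 0 \<le> i \<and> i < int (length w) then (if w ! nat i then {1} else {0}) else {})"

text \<open>The final test sits at address \<open>clen c\<close>: falling through leads to
  \<open>clen c + 1\<close>, the accepting state, and the jump to \<open>clen c + 2\<close>, the
  rejecting one.\<close>

definition decider :: "tprog \<Rightarrow> nat \<Rightarrow> tm" where
  "decider c k = machine (code 0 c @ [IBr (\<lambda>A. k \<in> A) (clen c + 2)])"

lemma decider_answers:
  assumes "texec c (init_tape w) 0 t T h" "t + 1 \<le> B"
  shows "answers_within (decider c k) w B (k \<in> T h)"
proof -
  let ?is = "code 0 c @ [IBr (\<lambda>A. k \<in> A) (clen c + 2)]"
  have r: "\<forall>i. init_tape w i \<subseteq> {..<ntracks}" by (auto simp: init_tape_def ntracks_def)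
  have i: "init_config w = conf 0 (init_tape w) 0"
    by (auto simp: init_config_def init_tape_def fun_eq_iff set_encode_def)
  have 1: "(step (machine ?is) ^^ t) (conf 0 (init_tape w) 0) = conf (clen c) T h"
    "\<forall>i. T i \<subseteq> {..<ntracks}"
    using texec_machine[OF assms(1) r, of ?is "[]" "[IBr (\<lambda>A. k \<in> A) (clen c + 2)]"] by auto
  then have fin: "finite (T h)" using finite_subset by blast
  have 2: "(step (machine ?is) ^^ 1) (conf (clen c) T h) = conf (if k \<in> T h then Suc (clen c) else clen c + 2) T h"
    using step_machine_Br[of "clen c" ?is "\<lambda>A. k \<in> A" "clen c + 2" T h] fin
    by (simp add: nth_append)
  have "run (decider c k) w (t + 1) = conf (if k \<in> T h then Suc (clen c) else clen c + 2) T h"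
    unfolding run_def decider_def i by (rule funpow_trans[OF 1(1) 2])
  then have "fst (run (decider c k) w (t + 1)) = (if k \<in> T h then acc (decider c k) else rej (decider c k))"
    by (auto simp: decider_def machine_def)
  with assms(2) show ?thesis unfolding answers_within_def by blast
qed

section \<open>Counter programs with an array\<close>

text \<open>\<open>N\<close> is the input length, \<open>V\<close> and \<open>VV\<close> hold W and
  2W, \<open>Pos\<close> is the reading position and \<open>Pos0\<close> the start of the list of
  maps. \<open>SA\<close>, \<open>AA\<close> and \<open>SB\<close>, \<open>BB\<close> are sign and
  absolute value of the two coefficients, \<open>YY\<close> and \<open>UU\<close> array indices.
  \<open>L1\<close> to \<open>L4\<close> count loops, from the outermost inwards.\<close>

datatype var = N | V | VV | Pos | Pos0 | SA | AA | SB | BB | Pw | YY | UU | PP | QQ | Ans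
  | Tmp | Dbl | L1 | L2 | L3 | L4

fun idx :: "var \<Rightarrow> nat" where
  "idx N = 0" | "idx V = 1" | "idx VV = 2" | "idx Pos = 3" | "idx Pos0 = 4" | "idx SA = 5"
| "idx AA = 6" | "idx SB = 7" | "idx BB = 8" | "idx Pw = 9" | "idx YY = 10" | "idx UU = 11"
| "idx PP = 12" | "idx QQ = 13" | "idx Ans = 14" | "idx Tmp = 15" | "idx Dbl = 16"
| "idx L1 = 17" | "idx L2 = 18" | "idx L3 = 19" | "idx L4 = 20"

lemma idx_inject [simp]: "idx u = idx v \<longleftrightarrow> u = v"
  by (cases u; cases v; simp)

lemma idx_less: "idx v < 21"
  by (cases v) auto

datatype track = In0 | In1 | Arr

fun track_index :: "track \<Rightarrow> nat" where
  "track_index In0 = 0" | "track_index In1 = 1" | "track_index Arr = 3"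

definition pebble :: "var \<Rightarrow> nat" where "pebble v = 4 + idx v"

datatype cmd = Skip | Inc var | Dec var | IfZ var cmd cmd | IfTr track var cmd cmd | SetS var
  | Seq cmd cmd (infixr ";;" 60) | Rep var cmd

text \<open>Beyond the input both \<open>In0\<close> and \<open>In1\<close> fail; this is how a
  program notices the end of the input.\<close>

fun track_test :: "bool list \<Rightarrow> nat set \<Rightarrow> track \<Rightarrow> nat \<Rightarrow> bool" where
  "track_test w S In0 i \<longleftrightarrow> i < length w \<and> \<not> w ! i"
| "track_test w S In1 i \<longleftrightarrow> i < length w \<and> w ! i"
| "track_test w S Arr i \<longleftrightarrow> i \<in> S"

text \<open>\<open>P\<close> caps the counters and thereby the length of every walk of the head. The
  condition in \<open>exec_RepS\<close> that the body restores its loop counter fixes the number of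
  iterations on entry, which makes a static time bound possible.\<close>

inductive exec :: "bool list \<Rightarrow> nat \<Rightarrow> cmd \<Rightarrow> (var \<Rightarrow> nat) \<Rightarrow> nat set \<Rightarrow> (var \<Rightarrow> nat) \<Rightarrow> nat set \<Rightarrow> bool"
  for w P where
  exec_Skip: "exec w P Skip s S s S"
| exec_Inc: "s v < P \<Longrightarrow> s' = s(v := s v + 1) \<Longrightarrow> exec w P (Inc v) s S s' S"
| exec_Dec: "s' = s(v := s v - 1) \<Longrightarrow> exec w P (Dec v) s S s' S"
| exec_IfZT: "s v = 0 \<Longrightarrow> exec w P c1 s S s' S' \<Longrightarrow> exec w P (IfZ v c1 c2) s S s' S'"
| exec_IfZF: "s v \<noteq> 0 \<Longrightarrow> exec w P c2 s S s' S' \<Longrightarrow> exec w P (IfZ v c1 c2) s S s' S'"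
| exec_IfTrT: "track_test w S t (s v) \<Longrightarrow> exec w P c1 s S s' S' \<Longrightarrow> exec w P (IfTr t v c1 c2) s S s' S'"
| exec_IfTrF: "\<not> track_test w S t (s v) \<Longrightarrow> exec w P c2 s S s' S' \<Longrightarrow> exec w P (IfTr t v c1 c2) s S s' S'"
| exec_SetS: "S' = insert (s v) S \<Longrightarrow> exec w P (SetS v) s S s S'"
| exec_Seq: "exec w P c1 s S s' S' \<Longrightarrow> exec w P c2 s' S' s'' S'' \<Longrightarrow> exec w P (c1 ;; c2) s S s'' S''"
| exec_Rep0: "s v = 0 \<Longrightarrow> exec w P (Rep v c) s S s S"
| exec_RepS: "s v \<noteq> 0 \<Longrightarrow> exec w P c (s(v := s v - 1)) S s' S' \<Longrightarrow> s' v = s v - 1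
    \<Longrightarrow> exec w P (Rep v c) s' S' s'' S'' \<Longrightarrow> exec w P (Rep v c) s S s'' S''"

section \<open>Counters as pebbles on the tape\<close>

definition seek :: "var \<Rightarrow> tprog" where
  "seek v = TWhile (\<lambda>A. pebble v \<notin> A) (Act id Rgt)"

definition home :: tprog where
  "home = TWhile (\<lambda>A. 2 \<notin> A) (Act id Lft)"

definition decr :: "var \<Rightarrow> tprog" where
  "decr v = TSeq (seek v) (TSeq (Act (\<lambda>A. A - {pebble v}) Lft) (TSeq (Act (insert (pebble v)) Stay) home))"

fun compile :: "cmd \<Rightarrow> tprog" where
  "compile Skip = Act id Stay"
| "compile (Inc v) =
     TSeq (seek v) (TSeq (Act (\<lambda>A. A - {pebble v}) Rgt) (TSeq (Act (insert (pebble v)) Stay) home))"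
| "compile (Dec v) = TIf (\<lambda>A. pebble v \<in> A) (Act id Stay) (decr v)"
| "compile (IfZ v c1 c2) = TIf (\<lambda>A. pebble v \<in> A) (compile c1) (compile c2)"
| "compile (IfTr t v c1 c2) =
     TSeq (seek v) (TIf (\<lambda>A. track_index t \<in> A) (TSeq home (compile c1)) (TSeq home (compile c2)))"
| "compile (SetS v) = TSeq (seek v) (TSeq (Act (insert 3) Stay) home)"
| "compile (c1 ;; c2) = TSeq (compile c1) (compile c2)"
| "compile (Rep v c) = TWhile (\<lambda>A. pebble v \<notin> A) (TSeq (decr v) (compile c))"

text \<open>A counter is a pebble on its own track, the array a track of marks on the nonnegative
  positions; track 2 marks the origin, to which the head returns between two commands.\<close>
definition marks :: "bool list \<Rightarrow> nat set \<Rightarrow> int \<Rightarrow> nat set" where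
  "marks w S i = (if 0 \<le> i \<and> track_test w S In0 (nat i) then {0} else {})
     \<union> (if 0 \<le> i \<and> track_test w S In1 (nat i) then {1} else {})
     \<union> (if i = 0 then {2} else {})
     \<union> (if 0 \<le> i \<and> track_test w S Arr (nat i) then {3} else {})"

definition tape :: "bool list \<Rightarrow> (var \<Rightarrow> nat) \<Rightarrow> nat set \<Rightarrow> int \<Rightarrow> nat set" where
  "tape w s S i = marks w S i \<union> pebble ` {v. int (s v) = i}"

lemma pebble_inject [simp]: "pebble u = pebble v \<longleftrightarrow> u = v"
  by (simp add: pebble_def)

lemma pebble_neq [simp]: "pebble v \<noteq> 0" "pebble v \<noteq> Suc 0" "pebble v \<noteq> 2" "pebble v \<noteq> 3"
    "0 \<noteq> pebble v" "Suc 0 \<noteq> pebble v" "2 \<noteq> pebble v" "3 \<noteq> pebble v"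
  by (auto simp: pebble_def)

lemma pebble_less [simp]: "pebble v < ntracks"
  using idx_less[of v] by (simp add: pebble_def ntracks_def)

lemma pebble_notin_marks [simp]: "pebble v \<notin> marks w S i"
  by (auto simp: marks_def)

lemma tape_subset: "tape w s S i \<subseteq> {..<ntracks}"
  by (auto simp: tape_def marks_def split: if_splits) (auto simp: ntracks_def)

lemma tape_Int [simp]: "tape w s S i \<inter> {..<ntracks} = tape w s S i"
  using tape_subset by blast

lemma pebble_in_tape [simp]: "pebble v \<in> tape w s S i \<longleftrightarrow> i = int (s v)"
  by (auto simp: tape_def)

lemma two_in_tape [simp]: "2 \<in> tape w s S i \<longleftrightarrow> i = 0"
  by (auto simp: tape_def marks_def)

lemma track_index_in_tape [simp]: "track_index t \<in> tape w s S (int i) \<longleftrightarrow> track_test w S t i"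
  by (cases t) (auto simp: tape_def marks_def)

lemma texec_stay: "texec (Act id d) (tape w s S) h 1 (tape w s S) (move d h)"
  using texec_Act[of id d "tape w s S" h] by simp

lemma texec_cong: "texec c T h t T' h' \<Longrightarrow> t = u \<Longrightarrow> T' = T'' \<Longrightarrow> h' = h'' \<Longrightarrow> texec c T h u T'' h''"
  by simp

lemma texec_seek_from:
  assumes "k \<le> s v"
  shows "texec (seek v) (tape w s S) (int (s v - k)) (3 * k + 1) (tape w s S) (int (s v))"
  using assms
proof (induction k)
  case 0
  then show ?case unfolding seek_def using texec_WhF[of "\<lambda>A. pebble v \<notin> A"] by auto
next
  case (Suc k)
  then have "move Rgt (int (s v - Suc k)) = int (s v - k)" by (simp add: move_def)
  then have 1: "texec (Act id Rgt) (tape w s S) (int (s v - Suc k)) 1 (tape w s S) (int (s v - k))"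
    using texec_stay[of Rgt w s S "int (s v - Suc k)"] by simp
  show ?case unfolding seek_def
    by (rule texec_cong[OF texec_WhT[OF _ 1]]) (use Suc in \<open>auto simp: seek_def\<close>)
qed

lemma texec_seek: "texec (seek v) (tape w s S) 0 (3 * s v + 1) (tape w s S) (int (s v))"
  using texec_seek_from[of "s v" s v] by simp

lemma texec_home: "texec home (tape w s S) (int k) (3 * k + 1) (tape w s S) 0"
proof (induction k)
  case 0
  then show ?case unfolding home_def using texec_WhF[of "\<lambda>A. 2 \<notin> A"] by auto
next
  case (Suc k)
  then have "move Lft (int (Suc k)) = int k" by (simp add: move_def)
  then have 1: "texec (Act id Lft) (tape w s S) (int (Suc k)) 1 (tape w s S) (int k)"
    using texec_stay[of Lft w s S "int (Suc k)"] by simp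
  show ?case unfolding home_def
    by (rule texec_cong[OF texec_WhT[OF _ 1]]) (use Suc in \<open>auto simp: home_def\<close>)
qed

lemma tape_upd_var:
  "tape w (s(v := i)) S j = (if j = int i then insert (pebble v) else id) (tape w s S j - {pebble v})"
proof -
  have "pebble ` {u. int ((s(v := i)) u) = j}
      = (if j = int i then insert (pebble v) else id) (pebble ` {u. int (s u) = j} - {pebble v})"
    by (auto split: if_splits)
  then show ?thesis
    by (auto simp: tape_def)
qed

lemma texec_move_pebble:
  assumes "move d (int (s v)) = int i" "i \<noteq> s v"
  shows "texec (TSeq (seek v) (TSeq (Act (\<lambda>A. A - {pebble v}) d) (TSeq (Act (insert (pebble v)) Stay) home)))
    (tape w s S) 0 (3 * s v + 3 * i + 4) (tape w (s(v := i)) S) 0"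
proof -
  let ?T = "(tape w s S)(int (s v) := (tape w s S (int (s v)) - {pebble v}) \<inter> {..<ntracks})"
  have 1: "texec (Act (\<lambda>A. A - {pebble v}) d) (tape w s S) (int (s v)) 1 ?T (int i)"
    using texec_Act[of "\<lambda>A. A - {pebble v}" d "tape w s S" "int (s v)"] unfolding assms .
  have m: "move Stay (int i) = int i" by (simp add: move_def)
  have "?T(int i := insert (pebble v) (?T (int i)) \<inter> {..<ntracks}) = tape w (s(v := i)) S"
  proof (rule ext)
    fix j
    have "A - {pebble v} \<inter> {..<ntracks} = A - {pebble v}" if "A \<subseteq> {..<ntracks}" for A
      using that by blast
    with tape_subset[of w s S j] tape_subset[of w s S "int (s v)"] assms(2)
    show "(?T(int i := insert (pebble v) (?T (int i)) \<inter> {..<ntracks})) j = tape w (s(v := i)) S j"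
      by (auto simp: tape_upd_var)
  qed
  then have 2: "texec (Act (insert (pebble v)) Stay) ?T (int i) 1 (tape w (s(v := i)) S) (int i)"
    using texec_Act[of "insert (pebble v)" Stay ?T "int i"] m by simp
  show ?thesis
    by (rule texec_cong[OF texec_Seq[OF texec_seek texec_Seq[OF 1 texec_Seq[OF 2 texec_home]]]]) auto
qed

lemma texec_Inc: "texec (compile (Inc v)) (tape w s S) 0 (6 * s v + 7) (tape w (s(v := s v + 1)) S) 0"
  unfolding compile.simps
  by (rule texec_cong[OF texec_move_pebble[of Rgt s v "s v + 1" w S]]) (simp_all add: move_def)

lemma texec_decr:
  assumes "s v \<noteq> 0"
  shows "texec (decr v) (tape w s S) 0 (6 * s v + 1) (tape w (s(v := s v - 1)) S) 0"
  unfolding decr_def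
  by (rule texec_cong[OF texec_move_pebble[of Lft s v "s v - 1" w S]]) (use assms in \<open>simp_all add: move_def\<close>)

lemma texec_SetS: "texec (compile (SetS v)) (tape w s S) 0 (6 * s v + 3) (tape w s (insert (s v) S)) 0"
proof -
  have 3: "move Stay (int (s v)) = int (s v)" by (simp add: move_def)
  have *: "insert 3 (tape w s S j) \<inter> {..<ntracks} = insert 3 (tape w s S j)" for j
    using tape_subset[of w s S j] by (auto simp: ntracks_def)
  have 2: "(tape w s S)(int (s v) := insert 3 (tape w s S (int (s v))) \<inter> {..<ntracks})
      = tape w s (insert (s v) S)"
  proof (rule ext)
    fix j
    have "marks w (insert (s v) S) j = (if j = int (s v) then insert 3 else id) (marks w S j)"
      by (auto simp: marks_def)
    then show "((tape w s S)(int (s v) := insert 3 (tape w s S (int (s v))) \<inter> {..<ntracks})) j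
        = tape w s (insert (s v) S) j"
      using * by (auto simp: tape_def)
  qed
  have 1: "texec (Act (insert 3) Stay) (tape w s S) (int (s v)) 1 (tape w s (insert (s v) S)) (int (s v))"
    using texec_Act[of "insert 3" Stay "tape w s S" "int (s v)"] unfolding 2 3 .
  show ?thesis
    unfolding compile.simps
    by (rule texec_cong[OF texec_Seq[OF texec_seek texec_Seq[OF 1 texec_home]]]) auto
qed

section \<open>Running time of compiled counter programs\<close>

text \<open>\<open>q\<close> bounds at once the cost of a basic command and the value of a counter;
  \<open>6 * P + 10\<close> does both, as walking to a pebble and back takes about six steps per
  cell.\<close>

fun tbound :: "nat \<Rightarrow> cmd \<Rightarrow> nat" where
  "tbound q (IfZ v c1 c2) = q + tbound q c1 + tbound q c2"
| "tbound q (IfTr t v c1 c2) = q + tbound q c1 + tbound q c2"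
| "tbound q (c1 ;; c2) = tbound q c1 + tbound q c2"
| "tbound q (Rep v c) = q * (tbound q c + q) + q"
| "tbound q _ = q"

text \<open>The induction over executions reenters a loop with a smaller counter, so there the bound
  must depend on the current value. \<open>tbound_at_le\<close> forgets that value again.\<close>

fun tbound_at :: "nat \<Rightarrow> (var \<Rightarrow> nat) \<Rightarrow> cmd \<Rightarrow> nat" where
  "tbound_at q s (Rep v c) = s v * (tbound q c + q) + q"
| "tbound_at q s c = tbound q c"

lemma tbound_at_le:
  assumes "\<And>v. s v \<le> P"
  shows "tbound_at (6 * P + 10) s c \<le> tbound (6 * P + 10) c"
proof -
  have "s v \<le> 6 * P + 10" for v using assms[of v] by simp
  then show ?thesis by (cases c) (auto intro: mult_le_mono1)
qed

lemma exec_bounded: "exec w P c s S s' S' \<Longrightarrow> (\<And>u. s u \<le> P) \<Longrightarrow> s' x \<le> P"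
proof (induction arbitrary: x rule: exec.induct)
  case (exec_Dec s' s v S)
  show ?case unfolding exec_Dec(1) using exec_Dec.prems[of x] by (cases "x = v") simp_all
next
  case (exec_Inc s v s' S)
  show ?case unfolding exec_Inc(2) using exec_Inc(1) exec_Inc.prems[of x] by simp
next
  case (exec_Seq c1 s S s' S' c2 s'' S'')
  show ?case by (rule exec_Seq.IH(2)[OF exec_Seq.IH(1)[OF exec_Seq.prems]])
next
  case (exec_RepS s v c S s' S' s'' S'')
  have "(s(v := s v - 1)) u \<le> P" for u
    using exec_RepS.prems[of u] exec_RepS.prems[of v] by auto
  note exec_RepS.IH(1)[OF this]
  then show ?case by (rule exec_RepS.IH(2))
qed blast+

lemma exec_compile:
  assumes "exec w P c s S s' S'" "\<And>v. s v \<le> P"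
  shows "\<exists>t \<le> tbound_at (6 * P + 10) s c. texec (compile c) (tape w s S) 0 t (tape w s' S') 0"
  using assms
proof (induction rule: exec.induct)
  case (exec_Skip s S)
  have "move Stay 0 = 0" by (simp add: move_def)
  then show ?case using texec_stay[of Stay w s S 0] by (auto intro!: exI[of _ 1])
next
  case (exec_Inc s v s' S)
  show ?case unfolding exec_Inc(2)
    by (intro exI[of _ "6 * s v + 7"] conjI texec_Inc) (use exec_Inc(1) in simp)
next
  case (exec_Dec s' s v S)
  have m: "move Stay 0 = 0" by (simp add: move_def)
  show ?case
  proof (cases "s v = 0")
    case True
    then have "s' = s" using exec_Dec by auto
    moreover have "texec (compile (Dec v)) (tape w s S) 0 (1 + 1 + 1) (tape w s S) 0"
      using texec_IfT[of "\<lambda>A. pebble v \<in> A", OF _ texec_stay[of Stay w s S 0]] True m by simp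
    ultimately show ?thesis by (auto intro!: exI[of _ 3] simp: numeral_3_eq_3)
  next
    case False
    then have "texec (compile (Dec v)) (tape w s S) 0 (1 + (6 * s v + 1)) (tape w s' S) 0"
      using texec_IfF[of "\<lambda>A. pebble v \<in> A", OF _ texec_decr[of s v w S]] exec_Dec by simp
    then show ?thesis using exec_Dec(2)[of v]
      by (intro exI[of _ "1 + (6 * s v + 1)"]) simp
  qed
next
  case (exec_IfZT s v c1 S s' S' c2)
  then obtain t where t: "t \<le> tbound_at (6 * P + 10) s c1" "texec (compile c1) (tape w s S) 0 t (tape w s' S') 0"
    by blast
  have "tbound_at (6 * P + 10) s c1 \<le> tbound (6 * P + 10) c1"
    by (rule tbound_at_le) (rule exec_IfZT.prems)
  with t texec_IfT[of "\<lambda>A. pebble v \<in> A", OF _ t(2)] exec_IfZT(1) show ?case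
    by (intro exI[of _ "1 + t + 1"]) auto
next
  case (exec_IfZF s v c2 S s' S' c1)
  then obtain t where t: "t \<le> tbound_at (6 * P + 10) s c2" "texec (compile c2) (tape w s S) 0 t (tape w s' S') 0"
    by blast
  have "tbound_at (6 * P + 10) s c2 \<le> tbound (6 * P + 10) c2"
    by (rule tbound_at_le) (rule exec_IfZF.prems)
  with t texec_IfF[of "\<lambda>A. pebble v \<in> A", OF _ t(2)] exec_IfZF(1) show ?case
    by (intro exI[of _ "1 + t"]) auto
next
  case (exec_IfTrT S t' s v c1 s' S' c2)
  then obtain t where t: "t \<le> tbound_at (6 * P + 10) s c1" "texec (compile c1) (tape w s S) 0 t (tape w s' S') 0"
    by blast
  have "tbound_at (6 * P + 10) s c1 \<le> tbound (6 * P + 10) c1"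
    by (rule tbound_at_le) (rule exec_IfTrT.prems)
  moreover have "texec (compile (IfTr t' v c1 c2)) (tape w s S) 0
     ((3 * s v + 1) + (1 + ((3 * s v + 1) + t) + 1)) (tape w s' S') 0"
    unfolding compile.simps
    by (intro texec_Seq[OF texec_seek] texec_IfT texec_Seq[OF texec_home t(2)]) (use exec_IfTrT(1) in simp)
  ultimately show ?case using t(1) exec_IfTrT.prems[of v]
    by (intro exI[of _ "(3 * s v + 1) + (1 + ((3 * s v + 1) + t) + 1)"]) auto
next
  case (exec_IfTrF S t' s v c2 s' S' c1)
  then obtain t where t: "t \<le> tbound_at (6 * P + 10) s c2" "texec (compile c2) (tape w s S) 0 t (tape w s' S') 0"
    by blast
  have "tbound_at (6 * P + 10) s c2 \<le> tbound (6 * P + 10) c2"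
    by (rule tbound_at_le) (rule exec_IfTrF.prems)
  moreover have "texec (compile (IfTr t' v c1 c2)) (tape w s S) 0
     ((3 * s v + 1) + (1 + ((3 * s v + 1) + t))) (tape w s' S') 0"
    unfolding compile.simps
    by (intro texec_Seq[OF texec_seek] texec_IfF texec_Seq[OF texec_home t(2)]) (use exec_IfTrF(1) in simp)
  ultimately show ?case using t(1) exec_IfTrF.prems[of v]
    by (intro exI[of _ "(3 * s v + 1) + (1 + ((3 * s v + 1) + t))"]) auto
next
  case (exec_SetS S' s v S)
  have "6 * s v \<le> 6 * P" using exec_SetS.prems[of v] by simp
  then show ?case using texec_SetS[of v w s S] exec_SetS(1)
    by (intro exI[of _ "6 * s v + 3"]) simp
next
  case (exec_Seq c1 s S s' S' c2 s'' S'')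
  have b: "s' v \<le> P" for v using exec_bounded[OF exec_Seq(1)] exec_Seq.prems by blast
  obtain t1 where t1: "t1 \<le> tbound_at (6 * P + 10) s c1" "texec (compile c1) (tape w s S) 0 t1 (tape w s' S') 0"
    using exec_Seq by blast
  obtain t2 where t2: "t2 \<le> tbound_at (6 * P + 10) s' c2" "texec (compile c2) (tape w s' S') 0 t2 (tape w s'' S'') 0"
    using exec_Seq.IH(2)[OF b] by blast
  have "tbound_at (6 * P + 10) s c1 \<le> tbound (6 * P + 10) c1"
    by (rule tbound_at_le) (rule exec_Seq.prems)
  moreover have "tbound_at (6 * P + 10) s' c2 \<le> tbound (6 * P + 10) c2"
    by (rule tbound_at_le) (rule b)
  ultimately show ?case using t1(1) t2(1) texec_Seq[OF t1(2) t2(2)]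
    by (intro exI[of _ "t1 + t2"]) auto
next
  case (exec_Rep0 s v c S)
  then show ?case using texec_WhF[of "\<lambda>A. pebble v \<notin> A" "tape w s S" 0] by (intro exI[of _ 1]) auto
next
  case (exec_RepS s v c S s' S' s'' S'')
  have b: "(s(v := s v - 1)) u \<le> P" for u using exec_RepS.prems[of u] by auto
  have b': "s' u \<le> P" for u using exec_bounded[OF exec_RepS(2)] b by blast
  obtain t1 where t1: "t1 \<le> tbound_at (6 * P + 10) (s(v := s v - 1)) c"
      "texec (compile c) (tape w (s(v := s v - 1)) S) 0 t1 (tape w s' S') 0"
    using exec_RepS.IH(1)[OF b] by blast
  obtain t2 where t2: "t2 \<le> tbound_at (6 * P + 10) s' (Rep v c)"
      "texec (compile (Rep v c)) (tape w s' S') 0 t2 (tape w s'' S'') 0"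
    using exec_RepS.IH(2)[OF b'] by blast
  have t1': "t1 \<le> tbound (6 * P + 10) c"
    by (rule order.trans[OF t1(1)], rule tbound_at_le, rule b)
  have ts: "texec (compile (Rep v c)) (tape w s S) 0 (1 + ((6 * s v + 1) + t1) + 1 + t2) (tape w s'' S'') 0"
    unfolding compile.simps
    by (intro texec_WhT[OF _ texec_Seq[OF texec_decr[of s v w S, OF exec_RepS(1)] t1(2)] t2(2)[unfolded compile.simps]])
      (use exec_RepS(1) in simp)
  obtain k where k: "s v = Suc k" using exec_RepS(1) not0_implies_Suc by blast
  have "6 * s v \<le> 6 * P" using exec_RepS.prems[of v] by simp
  then have "1 + ((6 * s v + 1) + t1) + 1 + t2 \<le> tbound_at (6 * P + 10) s (Rep v c)"
    using t1' t2(1) exec_RepS(3) k by (simp add: algebra_simps)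
  with ts show ?case by blast
qed

text \<open>The degree of a polynomial time bound: each constructor costs two or three factors
  \<open>q\<close> beyond the product of the bounds of its parts. It depends on the program alone,
  not on the input.\<close>

fun csize :: "cmd \<Rightarrow> nat" where
  "csize (IfZ v c1 c2) = csize c1 + csize c2 + 2"
| "csize (IfTr t v c1 c2) = csize c1 + csize c2 + 2"
| "csize (c1 ;; c2) = csize c1 + csize c2 + 2"
| "csize (Rep v c) = csize c + 3"
| "csize _ = 1"

lemma tbound_le_power:
  assumes "q \<ge> 3"
  shows "tbound q c \<le> q ^ csize c"
proof (induction c)
  case (IfZ v c1 c2)
  let ?e = "q ^ (csize c1 + csize c2)"
  have "q ^ csize c1 \<le> ?e" "q ^ csize c2 \<le> ?e" "1 \<le> ?e" using assms by (simp_all add: power_add)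
  then have "q + q ^ csize c1 + q ^ csize c2 \<le> q * ?e + ?e + ?e" by (intro add_mono) auto
  also have "\<dots> = (q + 2) * ?e" by (simp add: algebra_simps)
  also have "\<dots> \<le> (q * q) * ?e"
  proof -
    have "q + 2 \<le> 3 * q" using assms by simp
    also have "\<dots> \<le> q * q" using assms by simp
    finally show ?thesis by (rule mult_right_mono) simp
  qed
  finally show ?case using IfZ by (simp add: power_add power2_eq_square)
next
  case (IfTr t v c1 c2)
  let ?e = "q ^ (csize c1 + csize c2)"
  have "q ^ csize c1 \<le> ?e" "q ^ csize c2 \<le> ?e" "1 \<le> ?e" using assms by (simp_all add: power_add)
  then have "q + q ^ csize c1 + q ^ csize c2 \<le> q * ?e + ?e + ?e" by (intro add_mono) auto
  also have "\<dots> = (q + 2) * ?e" by (simp add: algebra_simps)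
  also have "\<dots> \<le> (q * q) * ?e"
  proof -
    have "q + 2 \<le> 3 * q" using assms by simp
    also have "\<dots> \<le> q * q" using assms by simp
    finally show ?thesis by (rule mult_right_mono) simp
  qed
  finally show ?case using IfTr by (simp add: power_add power2_eq_square)
next
  case (Seq c1 c2)
  let ?e = "q ^ (csize c1 + csize c2)"
  have "q ^ csize c1 \<le> ?e" "q ^ csize c2 \<le> ?e" using assms by (simp_all add: power_add)
  then have "q ^ csize c1 + q ^ csize c2 \<le> 2 * ?e" by simp
  also have "\<dots> \<le> (q * q) * ?e"
  proof -
    have "2 \<le> 3 * q" using assms by simp
    also have "\<dots> \<le> q * q" using assms by simp
    finally show ?thesis by (rule mult_right_mono) simp
  qed
  finally show ?case using Seq by (simp add: power_add power2_eq_square)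
next
  case (Rep v c)
  have "q * (q ^ csize c + q) + q \<le> q * (q ^ csize c * q + q ^ csize c * q) + q ^ csize c * (q * q)"
    using assms by (intro add_mono mult_mono) auto
  also have "\<dots> = 3 * (q * q * q ^ csize c)" by (simp add: algebra_simps)
  also have "\<dots> \<le> q * (q * q * q ^ csize c)" using assms by (intro mult_right_mono) auto
  finally have *: "q * (q ^ csize c + q) + q \<le> q ^ csize (Rep v c)"
    by (simp add: power_add power3_eq_cube algebra_simps)
  have "tbound q (Rep v c) \<le> q * (q ^ csize c + q) + q"
    unfolding tbound.simps by (intro add_mono mult_mono Rep) auto
  from order.trans[OF this *] show ?case .
qed auto

text \<open>The preamble puts all pebbles except that of \<^term>\<open>N\<close> on the origin, and that of \<^term>\<open>N\<close>
  at the end of the input.\<close>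
definition preamble :: tprog where
  "preamble = TSeq (Act (\<lambda>A. A \<union> {2} \<union> pebble ` (- {N})) Stay)
     (TSeq (TWhile (\<lambda>A. 0 \<in> A \<or> 1 \<in> A) (Act id Rgt)) (TSeq (Act (insert (pebble N)) Stay) home))"

lemma texec_preamble:
  "texec preamble (init_tape w) 0 (6 * length w + 4) (tape w ((\<lambda>_. 0)(N := length w)) {}) 0"
proof -
  define T where "T = (init_tape w)(0 := (init_tape w 0 \<union> {2} \<union> pebble ` (- {N})) \<inter> {..<ntracks})"
  have "(init_tape w 0 \<union> {2} \<union> pebble ` (- {N})) \<inter> {..<ntracks} = init_tape w 0 \<union> {2} \<union> pebble ` (- {N})"
    by (auto simp: init_tape_def) (auto simp: ntracks_def)
  then have Tr: "T i = init_tape w i \<union> (if i = 0 then {2} \<union> pebble ` (- {N}) else {})" for i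
    by (auto simp: T_def)
  have Ts: "T i \<inter> {..<ntracks} = T i" for i
    by (auto simp: Tr init_tape_def) (auto simp: ntracks_def)
  have scan: "texec (TWhile (\<lambda>A. 0 \<in> A \<or> 1 \<in> A) (Act id Rgt)) T (int (length w - k)) (3 * k + 1) T (int (length w))"
    if "k \<le> length w" for k
    using that
  proof (induction k)
    case 0
    have "\<not> (0 \<in> T (int (length w)) \<or> 1 \<in> T (int (length w)))"
      by (auto simp: Tr init_tape_def)
    then show ?case using texec_WhF[of "\<lambda>A. 0 \<in> A \<or> 1 \<in> A" T "int (length w)"] by simp
  next
    case (Suc k)
    have 1: "texec (Act id Rgt) T (int (length w - Suc k)) 1 T (int (length w - k))"
      using texec_Act[of id Rgt T "int (length w - Suc k)"] Suc.prems
      by (simp add: Ts move_def)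
    have c: "0 \<in> T (int (length w - Suc k)) \<or> 1 \<in> T (int (length w - Suc k))"
      using Suc.prems by (auto simp: Tr init_tape_def)
    show ?case
      by (rule texec_cong[OF texec_WhT[OF c 1 Suc.IH]]) (use Suc.prems in auto)
  qed
  have m: "move Stay h = h" for h by (simp add: move_def)
  have *: "insert (pebble N) (T i) \<inter> {..<ntracks} = insert (pebble N) (T i)" for i
    using Ts[of i] by auto
  have pebbles: "pebble ` {v. int (((\<lambda>_. 0)(N := length w)) v) = j}
      = (if j = 0 then pebble ` (- {N}) else {}) \<union> (if j = int (length w) then {pebble N} else {})" for j
  proof -
    have "{v. int (((\<lambda>_. 0)(N := length w)) v) = j}
        = (if j = 0 then - {N} else {}) \<union> (if j = int (length w) then {N} else {})"
      by (auto split: if_splits)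
    then show ?thesis
      by (cases "j = 0"; cases "j = int (length w)")
        (simp_all only: if_True if_False refl image_Un image_insert image_empty)
  qed
  have mk: "marks w {} j = init_tape w j \<union> (if j = 0 then {2} else {})" for j
    by (auto simp: init_tape_def marks_def)
  have "tape w ((\<lambda>_. 0)(N := length w)) {} j
      = (if j = int (length w) then insert (pebble N) (T j) else T j)" for j
    unfolding tape_def pebbles Tr mk by (cases "j = 0"; cases "j = int (length w)") (simp_all add: Un_ac)
  then have "T(int (length w) := insert (pebble N) (T (int (length w))) \<inter> {..<ntracks})
      = tape w ((\<lambda>_. 0)(N := length w)) {}"
    unfolding * by (intro ext) simp
  then have 2: "texec (Act (insert (pebble N)) Stay) T (int (length w)) 1 (tape w ((\<lambda>_. 0)(N := length w)) {}) (int (length w))"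
    using texec_Act[of "insert (pebble N)" Stay T "int (length w)"] unfolding m by simp
  have 3: "texec (Act (\<lambda>A. A \<union> {2} \<union> pebble ` (- {N})) Stay) (init_tape w) 0 1 T 0"
    using texec_Act[of "\<lambda>A. A \<union> {2} \<union> pebble ` (- {N})" Stay "init_tape w" 0] unfolding m T_def .
  have 4: "texec (TWhile (\<lambda>A. 0 \<in> A \<or> 1 \<in> A) (Act id Rgt)) T 0 (3 * length w + 1) T (int (length w))"
    using scan[of "length w"] by simp
  show ?thesis unfolding preamble_def
    by (rule texec_cong[OF texec_Seq[OF 3 texec_Seq[OF 4 texec_Seq[OF 2 texec_home]]]]) auto
qed

text \<open>The program ends with the head at the origin, where the pebble of \<open>Ans\<close>
  lies exactly if \<open>Ans\<close> is 0. The two extra factors pay for the preamble and the final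
  test.\<close>

lemma exec_decider:
  assumes "exec w P c ((\<lambda>_. 0)(N := length w)) {} s S" "length w \<le> P"
  shows "answers_within (decider (TSeq preamble (compile c)) (pebble Ans)) w
     ((6 * P + 10) ^ (csize c + 2)) (s Ans = 0)"
proof -
  define s0 :: "var \<Rightarrow> nat" where "s0 = (\<lambda>_. 0)(N := length w)"
  define q where "q = 6 * P + 10"
  have b: "s0 v \<le> P" for v using assms(2) by (simp add: s0_def)
  have "exec w P c s0 {} s S" using assms(1) by (simp only: s0_def)
  from exec_compile[OF this b] obtain t where
    t: "t \<le> tbound_at q s0 c" "texec (compile c) (tape w s0 {}) 0 t (tape w s S) 0"
    unfolding q_def by (elim exE conjE)
  have "tbound_at q s0 c \<le> tbound q c"
    unfolding q_def by (rule tbound_at_le) (rule b)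
  moreover have "tbound q c \<le> q ^ csize c" by (rule tbound_le_power) (simp add: q_def)
  ultimately have t': "t \<le> q ^ csize c" using t(1) by linarith
  have "6 * length w + 4 + t + 1 \<le> q ^ (csize c + 2)"
  proof -
    have q: "1 \<le> q ^ csize c" by (simp add: q_def)
    have "6 * length w + 4 + 1 \<le> q * 1" using assms(2) by (simp add: q_def)
    also have "\<dots> \<le> q * q ^ csize c" using q by (rule mult_le_mono2)
    finally have "6 * length w + 4 + t + 1 \<le> (q + 1) * q ^ csize c" using t' by simp
    also have "\<dots> \<le> (q * q) * q ^ csize c"
    proof (rule mult_le_mono1)
      have "q + 1 \<le> 2 * q" by (simp add: q_def)
      also have "\<dots> \<le> q * q" by (rule mult_le_mono1) (simp add: q_def)
      finally show "q + 1 \<le> q * q" .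
    qed
    finally show ?thesis by (simp add: power_add power2_eq_square mult_ac)
  qed
  from decider_answers[OF texec_Seq[OF texec_preamble t(2)[unfolded s0_def]] this, of "pebble Ans"]
  have "answers_within (decider (TSeq preamble (compile c)) (pebble Ans)) w (q ^ (csize c + 2))
    (pebble Ans \<in> tape w s S 0)" .
  moreover have "pebble Ans \<in> tape w s S 0 \<longleftrightarrow> s Ans = 0" by auto
  ultimately show ?thesis by (simp only: q_def)
qed

section \<open>Deciding reachability by a counter program\<close>

lemma exec_cong: "exec w P c s S s' S' \<Longrightarrow> s' = s'' \<Longrightarrow> S' = S'' \<Longrightarrow> exec w P c s S s'' S''"
  by simp

text \<open>\<open>I i\<close> holds after i iterations, when the counter is \<open>n - i\<close>;
  the body then runs with the counter already lowered to \<open>n - Suc i\<close>. The final state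
  is existential, for loops whose effect on the array is only bounded, not known.\<close>

lemma exec_Rep_inv:
  assumes "I 0 s S" "s v = n"
    and step: "\<And>i s S. i < n \<Longrightarrow> I i s S \<Longrightarrow> s v = n - i \<Longrightarrow>
      \<exists>s' S'. exec w P c (s(v := n - Suc i)) S s' S' \<and> s' v = n - Suc i \<and> I (Suc i) s' S'"
  shows "\<exists>s' S'. exec w P (Rep v c) s S s' S' \<and> I n s' S' \<and> s' v = 0"
proof -
  have "\<exists>s' S'. exec w P (Rep v c) s S s' S' \<and> I n s' S' \<and> s' v = 0"
    if "I (n - k) s S" "s v = k" "k \<le> n" for k s S
    using that
  proof (induction k arbitrary: s S)
    case 0
    have "exec w P (Rep v c) s S s S" by (rule exec_Rep0) (rule 0(2))
    with 0 show ?case by (intro exI[of _ s] exI[of _ S]) simp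
  next
    case (Suc k)
    have i: "n - Suc k < n" "n - (n - Suc k) = Suc k" "n - (n - k) = k" "Suc (n - Suc k) = n - k"
      using Suc.prems(3) by auto
    from step[OF i(1) Suc.prems(1)] Suc.prems(2) obtain s' S' where
      s': "exec w P c (s(v := k)) S s' S'" "s' v = k" "I (n - k) s' S'"
      unfolding i by blast
    have "k \<le> n" using Suc.prems(3) by simp
    with Suc.IH[OF s'(3,2)] obtain s'' S'' where
      s'': "exec w P (Rep v c) s' S' s'' S''" "I n s'' S''" "s'' v = 0"
      by blast
    have "exec w P (Rep v c) s S s'' S''"
      by (rule exec_RepS[OF _ _ _ s''(1)]) (use s' Suc.prems in auto)
    with s'' show ?case by blast
  qed
  from this[of n s S] assms(1,2) show ?thesis by simp
qed

lemma exec_Rep_fun: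
  assumes "\<And>i. i < n \<Longrightarrow> exec w P c ((f i)(v := n - Suc i)) S (f (Suc i)) S"
    "\<And>i. i \<le> n \<Longrightarrow> f i v = n - i"
  shows "exec w P (Rep v c) (f 0) S (f n) S"
proof -
  have "\<exists>s' S'. exec w P (Rep v c) (f 0) S s' S' \<and> (s' = f n \<and> S' = S) \<and> s' v = 0"
  proof (rule exec_Rep_inv)
    fix i s S'
    assume "i < n" "s = f i \<and> S' = S"
    then show "\<exists>s' S''. exec w P c (s(v := n - Suc i)) S' s' S'' \<and> s' v = n - Suc i \<and> s' = f (Suc i) \<and> S'' = S"
      using assms(1)[of i] assms(2)[of "Suc i"] by (intro exI[of _ "f (Suc i)"] exI[of _ S]) simp
  next
    show "f 0 v = n" using assms(2)[of 0] by simp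
  qed simp
  then show ?thesis by blast
qed

section \<open>Arithmetic on counters\<close>

abbreviation "Clr x \<equiv> Rep x Skip"
abbreviation "Sub x y \<equiv> Rep y (Dec x)"
text \<open>Loops consume their counter; \<open>Tmp\<close> collects a copy from which
  \<open>y\<close> is restored.\<close>

definition Add :: "var \<Rightarrow> var \<Rightarrow> cmd" where
  "Add x y = Rep y (Inc x ;; Inc Tmp) ;; Rep Tmp (Inc y)"
definition Dup :: "var \<Rightarrow> cmd" where
  "Dup x = Add Dbl x ;; Rep Dbl (Inc x)"
definition For :: "var \<Rightarrow> var \<Rightarrow> cmd \<Rightarrow> cmd" where
  "For i y c = Add i y ;; Rep i c"
definition MulAdd :: "var \<Rightarrow> var \<Rightarrow> var \<Rightarrow> cmd" where
  "MulAdd x y z = For L4 y (Add x z)"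

lemma exec_Rep_det:
  assumes "s = f 0" "s' = f n" "\<And>i. i \<le> n \<Longrightarrow> f i v = n - i"
    "\<And>i. i < n \<Longrightarrow> exec w P c ((f i)(v := n - Suc i)) S (f (Suc i)) S"
  shows "exec w P (Rep v c) s S s' S"
  using exec_Rep_fun[of n w P c f v S] assms by blast

lemma exec_Clr: "exec w P (Clr x) s S (s(x := 0)) S"
proof -
  define f where "f i = s(x := s x - i)" for i
  show ?thesis
  proof (rule exec_Rep_det[of _ f _ "s x"])
    fix i
    have "(f i)(x := s x - Suc i) = f (Suc i)" by (simp add: f_def)
    then show "exec w P Skip ((f i)(x := s x - Suc i)) S (f (Suc i)) S" by (simp add: exec_Skip)
  qed (auto simp: f_def)
qed

lemma exec_Sub:
  assumes "x \<noteq> y"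
  shows "exec w P (Sub x y) s S (s(x := s x - s y, y := 0)) S"
proof -
  define f where "f i = s(x := s x - i, y := s y - i)" for i
  show ?thesis
  proof (rule exec_Rep_det[of _ f _ "s y"])
    fix i
    show "exec w P (Dec x) ((f i)(y := s y - Suc i)) S (f (Suc i)) S"
      by (rule exec_Dec) (use assms in \<open>auto simp: f_def fun_eq_iff\<close>)
  qed (use assms in \<open>auto simp: f_def\<close>)
qed

lemma exec_Rep_Inc:
  assumes "x \<noteq> y" "s x + s y \<le> P"
  shows "exec w P (Rep y (Inc x)) s S (s(x := s x + s y, y := 0)) S"
proof -
  define f where "f i = s(x := s x + i, y := s y - i)" for i
  show ?thesis
  proof (rule exec_Rep_det[of _ f _ "s y"])
    fix i assume "i < s y"
    then show "exec w P (Inc x) ((f i)(y := s y - Suc i)) S (f (Suc i)) S"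
      by (intro exec_Inc) (use assms in \<open>auto simp: f_def fun_eq_iff\<close>)
  qed (use assms in \<open>auto simp: f_def\<close>)
qed

lemma exec_Add:
  assumes "x \<noteq> y" "x \<noteq> Tmp" "y \<noteq> Tmp" "s Tmp = 0" "s x + s y \<le> P"
  shows "exec w P (Add x y) s S (s(x := s x + s y)) S"
proof -
  define f where "f i = s(x := s x + i, Tmp := i, y := s y - i)" for i
  have 1: "exec w P (Rep y (Inc x ;; Inc Tmp)) s S (s(x := s x + s y, Tmp := s y, y := 0)) S"
  proof (rule exec_Rep_det[of _ f _ "s y"])
    fix i assume i: "i < s y"
    show "exec w P (Inc x ;; Inc Tmp) ((f i)(y := s y - Suc i)) S (f (Suc i)) S"
    proof (rule exec_Seq[OF exec_Inc[OF _ refl] exec_Inc])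
      show "((f i)(y := s y - Suc i)) x < P" using i assms by (simp add: f_def)
    qed (use i assms in \<open>auto simp: f_def fun_eq_iff\<close>)
  qed (use assms in \<open>auto simp: f_def fun_eq_iff\<close>)
  show ?thesis unfolding Add_def
    by (rule exec_cong[OF exec_Seq[OF 1 exec_Rep_Inc]]) (use assms in \<open>auto simp: fun_eq_iff\<close>)
qed

lemma exec_Dup:
  assumes "x \<noteq> Tmp" "x \<noteq> Dbl" "s Tmp = 0" "s Dbl = 0" "2 * s x \<le> P"
  shows "exec w P (Dup x) s S (s(x := 2 * s x)) S"
  unfolding Dup_def
  by (rule exec_cong[OF exec_Seq[OF exec_Add exec_Rep_Inc]]) (use assms in \<open>auto simp: fun_eq_iff\<close>)

lemma exec_For:
  assumes "i \<noteq> y" "i \<noteq> Tmp" "y \<noteq> Tmp" "s Tmp = 0" "s i = 0" "s y \<le> P"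
    "exec w P (Rep i c) (s(i := s y)) S s' S'"
  shows "exec w P (For i y c) s S s' S'"
proof -
  have "exec w P (Add i y) s S (s(i := s y)) S"
    by (rule exec_cong[OF exec_Add]) (use assms in auto)
  from exec_Seq[OF this assms(7)] show ?thesis unfolding For_def .
qed

lemma exec_MulAdd:
  assumes "x \<noteq> y" "x \<noteq> z" "x \<noteq> Tmp" "y \<noteq> Tmp" "z \<noteq> Tmp" "x \<noteq> L4" "y \<noteq> L4" "z \<noteq> L4"
    "s Tmp = 0" "s L4 = 0" "s y \<le> P" "s x + s y * s z \<le> P"
  shows "exec w P (MulAdd x y z) s S (s(x := s x + s y * s z)) S"
  unfolding MulAdd_def
proof (rule exec_For)
  define f where "f i = s(x := s x + i * s z, L4 := s y - i)" for i
  show "exec w P (Rep L4 (Add x z)) (s(L4 := s y)) S (s(x := s x + s y * s z)) S"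
  proof (rule exec_Rep_det[of _ f _ "s y"])
    fix i assume i: "i < s y"
    have "(i + 1) * s z \<le> s y * s z" using i by (intro mult_le_mono1) simp
    then show "exec w P (Add x z) ((f i)(L4 := s y - Suc i)) S (f (Suc i)) S"
      by (intro exec_cong[OF exec_Add]) (use assms in \<open>auto simp: f_def fun_eq_iff\<close>)
  qed (use assms in \<open>auto simp: f_def fun_eq_iff\<close>)
qed (use assms in auto)

section \<open>Parsing the input\<close>

fun bval :: "bool list \<Rightarrow> nat" where
  "bval [] = 0"
| "bval (b # bs) = of_bool b + 2 * bval bs"

lemma bval_append: "bval (xs @ ys) = bval xs + 2 ^ length xs * bval ys"
  by (induction xs) (auto simp: algebra_simps)

lemma bval_less: "bval bs < 2 ^ length bs"
  by (induction bs) (auto simp: of_bool_def)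

lemma bval_enc_nat: "bval (enc_nat n) = n"
proof (induction n rule: enc_nat.induct)
  case (2 n)
  have "of_bool (odd (Suc n)) + 2 * (Suc n div 2) = Suc n"
    by (cases "odd (Suc n)") (auto elim!: oddE)
  with 2 show ?case by (simp del: of_bool_eq_iff)
qed simp

lemma length_sd: "length (sd bs) = 2 * length bs + 1"
  unfolding sd_def by (induction bs) auto

lemma sd_nth:
  assumes "k \<le> length bs"
  shows "(sd bs @ suf) ! (2 * k) \<longleftrightarrow> k < length bs"
    and "k < length bs \<Longrightarrow> (sd bs @ suf) ! (2 * k + 1) \<longleftrightarrow> bs ! k"
proof -
  have "((sd bs @ suf) ! (2 * k) \<longleftrightarrow> k < length bs)
    \<and> (k < length bs \<longrightarrow> ((sd bs @ suf) ! (2 * k + 1) \<longleftrightarrow> bs ! k))"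
    using assms
  proof (induction bs arbitrary: k)
    case (Cons b bs)
    have sd: "sd (b # bs) = True # b # sd bs" by (simp add: sd_def)
    show ?case
    proof (cases k)
      case (Suc m)
      with Cons.prems Cons.IH[of m] show ?thesis unfolding sd by simp
    qed (simp add: sd)
  qed (simp add: sd_def)
  then show "(sd bs @ suf) ! (2 * k) \<longleftrightarrow> k < length bs"
    and "k < length bs \<Longrightarrow> (sd bs @ suf) ! (2 * k + 1) \<longleftrightarrow> bs ! k" by auto
qed

text \<open>A flag True announces a bit, which is added with weight \<open>Pw\<close>, the current
  power of 2. On the terminator nothing happens, so the command may be repeated \<open>N\<close>
  times without knowing the number of bits.\<close>

definition ParseBit :: "var \<Rightarrow> cmd" where
  "ParseBit v = IfTr In1 Pos (Inc Pos ;; IfTr In1 Pos (Add v Pw) Skip ;; Dup Pw ;; Inc Pos) Skip"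

definition Parse :: "var \<Rightarrow> var \<Rightarrow> cmd" where
  "Parse sg v = Clr sg ;; Clr v ;; IfTr In1 Pos (Inc sg) Skip ;; Inc Pos ;; Inc Pw ;;
     For L3 N (ParseBit v) ;; Inc Pos ;; Clr Pw"

lemma exec_ParseBits:
  assumes w: "w = pre @ sd bs @ suf" and P: "2 ^ length w \<le> P"
    and v: "v \<notin> {Pos, Tmp, Dbl, Pw, L3, N}"
    and s: "s Pos = length pre" "s v = 0" "s Pw = 1" "s Tmp = 0" "s Dbl = 0" "s L3 = length w"
  shows "exec w P (Rep L3 (ParseBit v)) s S
    (s(Pos := length pre + 2 * length bs, v := bval bs, Pw := 2 ^ length bs, L3 := 0)) S"
proof -
  \<comment> \<open>The minimum with \<open>length bs\<close> expresses that the surplus iterations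
    idle on the terminator.\<close>
  define f where "f i = s(Pos := length pre + 2 * min i (length bs), v := bval (take i bs),
    Pw := 2 ^ min i (length bs), L3 := length w - i)" for i
  have lw: "2 * length bs + 1 + length pre \<le> length w" by (simp add: w length_sd)
  have lP: "length w \<le> P" using P less_exp[of "length w"] by linarith
  show ?thesis
  proof (rule exec_Rep_det[of _ f _ "length w"])
    fix i assume i: "i < length w"
    define s1 where "s1 = (f i)(L3 := length w - Suc i)"
    show "exec w P (ParseBit v) ((f i)(L3 := length w - Suc i)) S (f (Suc i)) S"
      unfolding s1_def[symmetric]
    proof (cases "i < length bs")
      case False
      then have "s1 Pos = length pre + 2 * length bs" using v by (auto simp: s1_def f_def)
      moreover have "w ! (length pre + 2 * length bs) = False"
        unfolding w using sd_nth(1)[of "length bs" bs suf] by (simp add: nth_append)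
      moreover have "s1 = f (Suc i)" using False by (auto simp: s1_def f_def)
      ultimately show "exec w P (ParseBit v) s1 S (f (Suc i)) S"
        unfolding ParseBit_def by (intro exec_IfTrF) (auto intro: exec_Skip)
    next
      case True
      have p: "s1 Pos = length pre + 2 * i" using v True by (auto simp: s1_def f_def)
      have b0: "w ! (length pre + 2 * i)"
        unfolding w using sd_nth(1)[of i bs suf] True by (simp add: nth_append)
      have b1: "w ! (length pre + 2 * i + 1) = bs ! i"
        unfolding w using sd_nth(2)[of i bs suf] True by (simp add: nth_append)
      have tk: "bval (take (Suc i) bs) = bval (take i bs) + of_bool (bs ! i) * 2 ^ i"
        using True by (simp add: take_Suc_conv_app_nth bval_append min_def)
      have le: "bval (take i bs) + 2 ^ i \<le> P" "2 * 2 ^ i \<le> P"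
      proof -
        have "bval (take i bs) < 2 ^ i" using bval_less[of "take i bs"] True by (simp add: min_def)
        moreover have "(2::nat) ^ Suc i \<le> 2 ^ length w" using lw True by (intro power_increasing) auto
        ultimately show "bval (take i bs) + 2 ^ i \<le> P" "2 * 2 ^ i \<le> P" using P by auto
      qed
      define s2 where "s2 = s1(Pos := length pre + 2 * i + 1)"
      define s3 where "s3 = s2(v := bval (take (Suc i) bs))"
      define s4 where "s4 = s3(Pw := 2 * 2 ^ i)"
      have 1: "exec w P (Inc Pos) s1 S s2 S"
        by (rule exec_Inc) (use lw lP True p in \<open>auto simp: s2_def\<close>)
      have 2: "exec w P (IfTr In1 Pos (Add v Pw) Skip) s2 S s3 S"
      proof (cases "bs ! i")
        case b: True
        have "exec w P (Add v Pw) s2 S s3 S"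
          by (rule exec_cong[OF exec_Add]) (use v s le tk b True in \<open>auto simp: s3_def s2_def s1_def f_def\<close>)
        then show ?thesis using b b1 lw True by (intro exec_IfTrT) (auto simp: s2_def)
      next
        case b: False
        then have "s3 = s2" using v tk True by (auto simp: s3_def s2_def s1_def f_def)
        then show ?thesis using b b1 by (intro exec_IfTrF) (auto simp: s2_def intro: exec_Skip)
      qed
      have 3: "exec w P (Dup Pw) s3 S s4 S"
        by (rule exec_cong[OF exec_Dup]) (use v s le True in \<open>auto simp: s4_def s3_def s2_def s1_def f_def\<close>)
      have 4: "exec w P (Inc Pos) s4 S (f (Suc i)) S"
      proof (rule exec_Inc)
        show "s4 Pos < P" using v lw lP True by (auto simp: s4_def s3_def s2_def)
        show "f (Suc i) = s4(Pos := s4 Pos + 1)"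
          using v True by (auto simp: s4_def s3_def s2_def s1_def f_def fun_eq_iff)
      qed
      show "exec w P (ParseBit v) s1 S (f (Suc i)) S"
        unfolding ParseBit_def
        by (intro exec_IfTrT exec_Seq[OF 1] exec_Seq[OF 2] exec_Seq[OF 3] 4)
          (use b0 p lw True in auto)
    qed
  qed (use lw v s in \<open>auto simp: f_def fun_eq_iff\<close>)
qed

lemma exec_Parse:
  assumes w: "w = pre @ enc_int z @ suf" and P: "2 ^ length w \<le> P"
    and v: "v \<notin> {Pos, Tmp, Dbl, Pw, L3, N}" "sg \<notin> {Pos, Tmp, Dbl, Pw, L3, N}" "sg \<noteq> v"
    and s: "s Pos = length pre" "s Pw = 0" "s Tmp = 0" "s Dbl = 0" "s L3 = 0" "s N = length w"
  shows "exec w P (Parse sg v) s S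
    (s(sg := of_bool (z < 0), v := nat \<bar>z\<bar>, Pos := length pre + length (enc_int z))) S"
proof -
  let ?bs = "enc_nat (nat \<bar>z\<bar>)"
  have lP: "length w < P" using P less_exp[of "length w"] by linarith
  have w1: "w = (pre @ [z < 0]) @ sd ?bs @ suf" by (simp add: w enc_int_def)
  have lw: "length pre + 2 * length ?bs + 2 \<le> length w" by (simp add: w1 length_sd)
  have b: "w ! length pre \<longleftrightarrow> z < 0" by (simp add: w enc_int_def)
  define s1 where "s1 = s(sg := 0, v := 0)"
  define s2 where "s2 = s1(sg := of_bool (z < 0))"
  define s3 where "s3 = s2(Pos := length pre + 1, Pw := 1)"
  define s4 where "s4 = s3(Pos := length pre + 1 + 2 * length ?bs, v := nat \<bar>z\<bar>, Pw := 2 ^ length ?bs)"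
  have 0: "exec w P (Clr v) (s(sg := 0)) S s1 S"
    by (rule exec_cong[OF exec_Clr]) (simp_all add: s1_def)
  have 1: "exec w P (IfTr In1 Pos (Inc sg) Skip) s1 S s2 S"
  proof (cases "z < 0")
    case True
    then show ?thesis using v s lP lw b
      by (intro exec_IfTrT exec_Inc) (auto simp: s1_def s2_def)
  next
    case False
    then have "s2 = s1" using v by (auto simp: s1_def s2_def)
    then show ?thesis using False v s b
      by (intro exec_IfTrF) (auto simp: s1_def intro: exec_Skip)
  qed
  have 2: "exec w P (For L3 N (ParseBit v)) s3 S s4 S"
  proof (rule exec_For)
    show "exec w P (Rep L3 (ParseBit v)) (s3(L3 := s3 N)) S s4 S"
      by (rule exec_cong[OF exec_ParseBits[OF w1 P v(1)]])
        (use v s in \<open>auto simp: s4_def s3_def s2_def s1_def fun_eq_iff bval_enc_nat\<close>)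
  qed (use v s lP in \<open>auto simp: s3_def s2_def s1_def\<close>)
  have 3: "exec w P (Inc Pos) s2 S (s2(Pos := length pre + 1)) S"
    by (rule exec_Inc) (use v s lP lw in \<open>auto simp: s2_def s1_def\<close>)
  have 4: "exec w P (Inc Pw) (s2(Pos := length pre + 1)) S s3 S"
    by (rule exec_Inc) (use v s lP lw in \<open>auto simp: s3_def s2_def s1_def\<close>)
  have 5: "exec w P (Inc Pos) s4 S (s4(Pos := length pre + 2 + 2 * length ?bs)) S"
    by (rule exec_Inc) (use v s lP lw in \<open>auto simp: s4_def\<close>)
  have l: "length (enc_int z) = 2 + 2 * length ?bs" by (simp add: enc_int_def length_sd)
  show ?thesis unfolding Parse_def
    by (rule exec_cong[OF exec_Seq[OF exec_Clr exec_Seq[OF 0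
      exec_Seq[OF 1 exec_Seq[OF 3 exec_Seq[OF 4 exec_Seq[OF 2 exec_Seq[OF 5 exec_Clr]]]]]]]])
      (use v s in \<open>auto simp: s4_def s3_def s2_def s1_def fun_eq_iff l\<close>)
qed

section \<open>One round of saturation\<close>

text \<open>The map conjugated by the offset \<open>W\<close> that turns values of the window into
  array indices.\<close>

definition shift :: "nat \<Rightarrow> int \<times> int \<Rightarrow> nat \<Rightarrow> int" where
  "shift W p u = aff p (int u - int W) + int W"

text \<open>Counters are natural numbers, so \<open>PP\<close> collects the positive and
  \<open>QQ\<close> the negative terms of a (u - W) + b + W + 1. The product contributes |a| u to
  one side and |a| W to the other, according to the sign of a. Because of the extra 1, truncated
  subtraction gives 0 exactly if the new index is negative; it is taken off before the index is
  marked.\<close>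

definition Body :: cmd where
  "Body = Add PP V ;; Inc PP ;; IfZ SB (Add PP BB) (Add QQ BB) ;;
     IfZ SA (MulAdd PP AA UU ;; MulAdd QQ AA V) (MulAdd PP AA V ;; MulAdd QQ AA UU) ;;
     Sub PP QQ ;; IfZ PP Skip (Dec PP ;; SetS PP) ;; Clr PP"

definition Scan :: cmd where
  "Scan = For L3 VV (IfTr Arr UU Body Skip ;; Inc UU) ;; Clr UU"

definition Step :: cmd where
  "Step = Parse SA AA ;; Parse SB BB ;; Scan ;; Clr SA ;; Clr AA ;; Clr SB ;; Clr BB"

definition Round :: cmd where
  "Round = Add Pos Pos0 ;; For L2 N (IfTr In0 Pos Step (IfTr In1 Pos Step Skip)) ;; Clr Pos"

lemma nat_less_power_enc: "nat \<bar>z\<bar> < 2 ^ length (enc_int z)"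
proof -
  have "nat \<bar>z\<bar> < 2 ^ length (enc_nat (nat \<bar>z\<bar>))"
    using bval_less[of "enc_nat (nat \<bar>z\<bar>)"] by (simp add: bval_enc_nat)
  also have "\<dots> \<le> 2 ^ length (enc_int z)"
    by (intro power_increasing) (auto simp: enc_int_def length_sd)
  finally show ?thesis .
qed

lemma exec_Body:
  fixes a b :: int
  assumes s: "s SA = of_bool (a < 0)" "s AA = nat \<bar>a\<bar>" "s SB = of_bool (b < 0)" "s BB = nat \<bar>b\<bar>"
    "s V = W" "s UU = u" "s PP = 0" "s QQ = 0" "s Tmp = 0" "s L4 = 0"
    and P: "nat \<bar>a\<bar> * u + nat \<bar>a\<bar> * W + nat \<bar>b\<bar> + W + 1 \<le> P" "nat \<bar>a\<bar> \<le> P"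
  shows "exec w P Body s S s
    (if 0 \<le> shift W (a, b) u then insert (nat (shift W (a, b) u)) S else S)"
proof -
  define \<alpha> \<beta> where "\<alpha> = nat \<bar>a\<bar>" and "\<beta> = nat \<bar>b\<bar>"
  define pb qb where "pb = W + 1 + (if b < 0 then 0 else \<beta>)" and "qb = (if b < 0 then \<beta> else 0)"
  define p q where "p = pb + \<alpha> * (if a < 0 then W else u)" and "q = qb + \<alpha> * (if a < 0 then u else W)"
  have pq: "int p - int q = shift W (a, b) u + 1"
    by (auto simp: p_def q_def pb_def qb_def \<alpha>_def \<beta>_def shift_def aff_def algebra_simps)
  have 1: "exec w P (Add PP V) s S (s(PP := W)) S"
    by (rule exec_cong[OF exec_Add]) (use s P in auto)
  have 2: "exec w P (Inc PP) (s(PP := W)) S (s(PP := W + 1)) S"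
    by (rule exec_Inc) (use s P in auto)
  have 3: "exec w P (IfZ SB (Add PP BB) (Add QQ BB)) (s(PP := W + 1)) S (s(PP := pb, QQ := qb)) S"
  proof (cases "b < 0")
    case True
    have "exec w P (Add QQ BB) (s(PP := W + 1)) S (s(PP := pb, QQ := qb)) S"
      by (rule exec_cong[OF exec_Add]) (use s P True in \<open>auto simp: pb_def qb_def \<beta>_def fun_eq_iff\<close>)
    then show ?thesis using True s by (intro exec_IfZF) auto
  next
    case False
    have "exec w P (Add PP BB) (s(PP := W + 1)) S (s(PP := pb, QQ := qb)) S"
      by (rule exec_cong[OF exec_Add]) (use s P False in \<open>auto simp: pb_def qb_def \<beta>_def fun_eq_iff\<close>)
    then show ?thesis using False s by (intro exec_IfZT) auto
  qed
  have bounds: "pb + \<alpha> * u \<le> P" "pb + \<alpha> * W \<le> P" "qb + \<alpha> * u \<le> P" "qb + \<alpha> * W \<le> P" "\<alpha> \<le> P"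
    using P by (auto simp: pb_def qb_def \<alpha>_def \<beta>_def)
  have 4: "exec w P (IfZ SA (MulAdd PP AA UU ;; MulAdd QQ AA V) (MulAdd PP AA V ;; MulAdd QQ AA UU))
    (s(PP := pb, QQ := qb)) S (s(PP := p, QQ := q)) S"
  proof (cases "a < 0")
    case True
    have "exec w P (MulAdd PP AA V ;; MulAdd QQ AA UU) (s(PP := pb, QQ := qb)) S (s(PP := p, QQ := q)) S"
      by (rule exec_cong[OF exec_Seq[OF exec_MulAdd exec_MulAdd]])
        (use s True bounds in \<open>auto simp: p_def q_def \<alpha>_def fun_eq_iff\<close>)
    then show ?thesis using True s by (intro exec_IfZF) auto
  next
    case False
    have "exec w P (MulAdd PP AA UU ;; MulAdd QQ AA V) (s(PP := pb, QQ := qb)) S (s(PP := p, QQ := q)) S"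
      by (rule exec_cong[OF exec_Seq[OF exec_MulAdd exec_MulAdd]])
        (use s False bounds in \<open>auto simp: p_def q_def \<alpha>_def fun_eq_iff\<close>)
    then show ?thesis using False s by (intro exec_IfZT) auto
  qed
  have 5: "exec w P (Sub PP QQ) (s(PP := p, QQ := q)) S (s(PP := p - q)) S"
    by (rule exec_cong[OF exec_Sub]) (use s in \<open>auto simp: fun_eq_iff\<close>)
  let ?S = "if 0 \<le> shift W (a, b) u then insert (nat (shift W (a, b) u)) S else S"
  have 6: "\<exists>k. exec w P (IfZ PP Skip (Dec PP ;; SetS PP)) (s(PP := p - q)) S (s(PP := k)) ?S"
  proof (cases "0 \<le> shift W (a, b) u")
    case True
    then have k: "p - q \<noteq> 0" "p - q - 1 = nat (shift W (a, b) u)" using pq by linarith+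
    have "exec w P (Dec PP ;; SetS PP) (s(PP := p - q)) S (s(PP := p - q - 1)) ?S"
      by (rule exec_Seq[OF exec_Dec[OF refl] exec_cong[OF exec_SetS[OF refl]]]) (use True k in auto)
    then show ?thesis using k by (intro exI[of _ "p - q - 1"] exec_IfZF) auto
  next
    case False
    then have "p - q = 0" using pq by linarith
    then show ?thesis using False by (intro exI[of _ 0] exec_IfZT) (auto intro: exec_Skip)
  qed
  then obtain k where 6: "exec w P (IfZ PP Skip (Dec PP ;; SetS PP)) (s(PP := p - q)) S (s(PP := k)) ?S" ..
  show ?thesis unfolding Body_def
    by (rule exec_cong[OF exec_Seq[OF 1 exec_Seq[OF 2 exec_Seq[OF 3 exec_Seq[OF 4 exec_Seq[OF 5 exec_Seq[OF 6 exec_Clr]]]]]]])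
      (use s in \<open>auto simp: fun_eq_iff\<close>)
qed

text \<open>The cap covers the sum |a| u + |a| W + |b| + W + 1 formed in \<open>Body\<close>, with u
  below 2W and |a|, |b| at most 2 ^ length w.\<close>

locale window =
  fixes w :: "bool list" and P W :: nat
  assumes P: "2 ^ length w * (3 * W + 1) + W + 1 \<le> P"
begin

lemma P_bounds: "2 ^ length w \<le> P" "length w < P" "W < P" "2 * W \<le> P"
proof -
  have "2 ^ length w * 1 \<le> 2 ^ length w * (3 * W + 1)" by (intro mult_le_mono2) simp
  then show *: "2 ^ length w \<le> P" using P by linarith
  show "length w < P" using * less_exp[of "length w"] by linarith
  show "W < P" using P by linarith
  have "2 * W \<le> 1 * (3 * W + 1)" by simp
  also have "\<dots> \<le> 2 ^ length w * (3 * W + 1)" by (intro mult_le_mono1) simp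
  also have "\<dots> \<le> P" using P by linarith
  finally show "2 * W \<le> P" .
qed

text \<open>The array changes while it is scanned, and an index marked in this pass may be expanded
  in the same pass, so the result need not be the exact image of \<open>S\<close>. Two bounds
  suffice: the successors of \<open>S\<close> get marked, and nothing leaves a set \<open>G\<close>
  closed under the map.\<close>

lemma exec_Scan:
  fixes a b :: int
  assumes s: "s SA = of_bool (a < 0)" "s AA = nat \<bar>a\<bar>" "s SB = of_bool (b < 0)" "s BB = nat \<bar>b\<bar>"
    "s V = W" "s VV = 2 * W" "s UU = 0" "s PP = 0" "s QQ = 0" "s Tmp = 0" "s L3 = 0" "s L4 = 0"
    and ab: "nat \<bar>a\<bar> \<le> 2 ^ length w" "nat \<bar>b\<bar> \<le> 2 ^ length w"
    and G: "\<And>u. u \<in> G \<Longrightarrow> 0 \<le> shift W (a, b) u \<Longrightarrow> nat (shift W (a, b) u) \<in> G" "S \<subseteq> G"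
  shows "\<exists>S'. exec w P Scan s S s S' \<and> S \<subseteq> S' \<and> S' \<subseteq> G
    \<and> (\<forall>u\<in>S. u < 2 * W \<longrightarrow> 0 \<le> shift W (a, b) u \<longrightarrow> nat (shift W (a, b) u) \<in> S')"
proof -
  define I where "I i s' S' \<longleftrightarrow> s' = s(UU := i, L3 := 2 * W - i) \<and> S \<subseteq> S' \<and> S' \<subseteq> G
    \<and> (\<forall>u\<in>S. u < i \<longrightarrow> 0 \<le> shift W (a, b) u \<longrightarrow> nat (shift W (a, b) u) \<in> S')" for i s' S'
  have "\<exists>s' S'. exec w P (Rep L3 (IfTr Arr UU Body Skip ;; Inc UU)) (s(L3 := 2 * W)) S s' S'
    \<and> I (2 * W) s' S' \<and> s' L3 = 0"
  proof (rule exec_Rep_inv)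
    show "I 0 (s(L3 := 2 * W)) S" using s G by (auto simp: I_def fun_eq_iff)
  next
    fix i s1 S1
    assume i: "i < 2 * W" and I: "I i s1 S1"
    define s2 where "s2 = s(UU := i, L3 := 2 * W - Suc i)"
    have s2: "s1(L3 := 2 * W - Suc i) = s2" using I by (auto simp: I_def s2_def)
    have b: "nat \<bar>a\<bar> * i + nat \<bar>a\<bar> * W + nat \<bar>b\<bar> + W + 1 \<le> P" "nat \<bar>a\<bar> \<le> P"
    proof -
      have "nat \<bar>a\<bar> * i + nat \<bar>a\<bar> * W \<le> 2 ^ length w * (2 * W) + 2 ^ length w * W"
        using i ab by (intro add_mono mult_mono) auto
      also have "\<dots> = 2 ^ length w * (3 * W)" by simp
      finally have "nat \<bar>a\<bar> * i + nat \<bar>a\<bar> * W \<le> 2 ^ length w * (3 * W)" .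
      moreover have "2 ^ length w * (3 * W) + 2 ^ length w + W + 1 \<le> P" using P by simp
      ultimately show "nat \<bar>a\<bar> * i + nat \<bar>a\<bar> * W + nat \<bar>b\<bar> + W + 1 \<le> P"
        using ab(2) by linarith
      show "nat \<bar>a\<bar> \<le> P" using ab P_bounds by linarith
    qed
    obtain S2 where S2: "exec w P (IfTr Arr UU Body Skip) s2 S1 s2 S2" "S1 \<subseteq> S2" "S2 \<subseteq> G"
      "i \<in> S1 \<longrightarrow> 0 \<le> shift W (a, b) i \<longrightarrow> nat (shift W (a, b) i) \<in> S2"
    proof (cases "i \<in> S1")
      case True
      have "exec w P Body s2 S1 s2 (if 0 \<le> shift W (a, b) i then insert (nat (shift W (a, b) i)) S1 else S1)"
        by (rule exec_Body) (use s b in \<open>auto simp: s2_def\<close>)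
      then have "exec w P (IfTr Arr UU Body Skip) s2 S1 s2
          (if 0 \<le> shift W (a, b) i then insert (nat (shift W (a, b) i)) S1 else S1)"
        using True by (intro exec_IfTrT) (auto simp: s2_def)
      then show ?thesis by (rule that) (use I G(1) True in \<open>auto simp: I_def\<close>)
    next
      case False
      then have "exec w P (IfTr Arr UU Body Skip) s2 S1 s2 S1"
        by (intro exec_IfTrF) (auto simp: s2_def intro: exec_Skip)
      then show ?thesis by (rule that) (use I False in \<open>auto simp: I_def\<close>)
    qed
    have 2: "exec w P (Inc UU) s2 S2 (s(UU := Suc i, L3 := 2 * W - Suc i)) S2"
      by (rule exec_Inc) (use i P_bounds in \<open>auto simp: s2_def\<close>)
    have "I (Suc i) (s(UU := Suc i, L3 := 2 * W - Suc i)) S2"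
      using I S2 by (auto simp: I_def less_Suc_eq)
    then show "\<exists>s' S'. exec w P (IfTr Arr UU Body Skip ;; Inc UU) (s1(L3 := 2 * W - Suc i)) S1 s' S'
        \<and> s' L3 = 2 * W - Suc i \<and> I (Suc i) s' S'"
      unfolding s2 using exec_Seq[OF S2(1) 2] by (intro exI conjI) (assumption | simp)+
  qed simp
  then obtain s' S' where *: "exec w P (Rep L3 (IfTr Arr UU Body Skip ;; Inc UU)) (s(L3 := 2 * W)) S s' S'"
    "I (2 * W) s' S'" by blast
  have "exec w P (For L3 VV (IfTr Arr UU Body Skip ;; Inc UU)) s S s' S'"
    by (rule exec_For) (use s P_bounds * in auto)
  then have "exec w P Scan s S (s'(UU := 0)) S'"
    unfolding Scan_def by (rule exec_Seq) (rule exec_Clr)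
  moreover have "s'(UU := 0) = s" using *(2) s by (auto simp: I_def fun_eq_iff)
  ultimately show ?thesis using *(2) by (auto simp: I_def)
qed

definition idle :: "(var \<Rightarrow> nat) \<Rightarrow> bool" where
  "idle s \<longleftrightarrow> s SA = 0 \<and> s AA = 0 \<and> s SB = 0 \<and> s BB = 0 \<and> s V = W \<and> s VV = 2 * W \<and> s UU = 0
    \<and> s PP = 0 \<and> s QQ = 0 \<and> s Pw = 0 \<and> s Tmp = 0 \<and> s Dbl = 0 \<and> s L3 = 0 \<and> s L4 = 0 \<and> s N = length w"

lemma exec_Step:
  assumes w: "w = pre @ (enc_int a @ enc_int b) @ suf" and s: "idle s" "s Pos = length pre"
    and G: "\<And>u. u \<in> G \<Longrightarrow> 0 \<le> shift W (a, b) u \<Longrightarrow> nat (shift W (a, b) u) \<in> G" "S \<subseteq> G"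
  shows "\<exists>S'. exec w P Step s S (s(Pos := length pre + length (enc_int a @ enc_int b))) S'
    \<and> S \<subseteq> S' \<and> S' \<subseteq> G
    \<and> (\<forall>u\<in>S. u < 2 * W \<longrightarrow> 0 \<le> shift W (a, b) u \<longrightarrow> nat (shift W (a, b) u) \<in> S')"
proof -
  have w1: "w = pre @ enc_int a @ (enc_int b @ suf)" and w2: "w = (pre @ enc_int a) @ enc_int b @ suf"
    using w by simp_all
  define s1 where "s1 = s(SA := of_bool (a < 0), AA := nat \<bar>a\<bar>, Pos := length pre + length (enc_int a))"
  define s2 where "s2 = s1(SB := of_bool (b < 0), BB := nat \<bar>b\<bar>, Pos := length pre + length (enc_int a @ enc_int b))"
  have 1: "exec w P (Parse SA AA) s S s1 S"
    by (rule exec_cong[OF exec_Parse[OF w1 P_bounds(1)]]) (use s in \<open>auto simp: s1_def idle_def\<close>)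
  have 2: "exec w P (Parse SB BB) s1 S s2 S"
    by (rule exec_cong[OF exec_Parse[OF w2 P_bounds(1)]]) (use s in \<open>auto simp: s2_def s1_def idle_def\<close>)
  have "nat \<bar>z\<bar> \<le> 2 ^ length w" if "z \<in> {a, b}" for z
  proof -
    have "(2::nat) ^ length (enc_int z) \<le> 2 ^ length w"
      by (rule power_increasing) (use that w in auto)
    then show ?thesis using nat_less_power_enc[of z] by linarith
  qed
  then have ab: "nat \<bar>a\<bar> \<le> 2 ^ length w" "nat \<bar>b\<bar> \<le> 2 ^ length w" by auto
  obtain S' where S': "exec w P Scan s2 S s2 S'" "S \<subseteq> S'" "S' \<subseteq> G"
    "\<forall>u\<in>S. u < 2 * W \<longrightarrow> 0 \<le> shift W (a, b) u \<longrightarrow> nat (shift W (a, b) u) \<in> S'"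
    using exec_Scan[of s2 a b G S, OF _ _ _ _ _ _ _ _ _ _ _ _ ab G] s
    by (auto simp: s2_def s1_def idle_def)
  have "exec w P Step s S (s(Pos := length pre + length (enc_int a @ enc_int b))) S'"
    unfolding Step_def
    by (rule exec_cong[OF exec_Seq[OF 1 exec_Seq[OF 2 exec_Seq[OF S'(1)
        exec_Seq[OF exec_Clr exec_Seq[OF exec_Clr exec_Seq[OF exec_Clr exec_Clr]]]]]]])
      (use s in \<open>auto simp: s2_def s1_def idle_def fun_eq_iff\<close>)
  with S' show ?thesis by blast
qed

abbreviation enc_fun :: "int \<times> int \<Rightarrow> bool list" where
  "enc_fun \<equiv> \<lambda>(a, b). enc_int a @ enc_int b"

lemma enc_int_neq_Nil [simp]: "enc_int z \<noteq> []"
  by (simp add: enc_int_def)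

lemma length_concat_enc: "length fs \<le> length (concat (map enc_fun fs))"
proof (induction fs)
  case (Cons p fs)
  obtain a b where p: "p = (a, b)" by fastforce
  have "length (enc_int a) \<noteq> 0" by simp
  then show ?case using Cons unfolding p list.map concat.simps length_append split list.size by linarith
qed simp

text \<open>Every code is nonempty, so \<open>N\<close> iterations are at least one per map. The
  surplus ones find neither input track marked at \<open>Pos\<close> and do nothing.\<close>

lemma exec_Round:
  assumes w: "w = pre @ concat (map enc_fun fs)"
    and s: "idle s" "s Pos = 0" "s Pos0 = length pre" "s L2 = 0"
    and G: "\<And>u p. u \<in> G \<Longrightarrow> p \<in> set fs \<Longrightarrow> 0 \<le> shift W p u \<Longrightarrow> nat (shift W p u) \<in> G" "S \<subseteq> G"
  shows "\<exists>S'. exec w P Round s S s S' \<and> S \<subseteq> S' \<and> S' \<subseteq> G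
    \<and> (\<forall>u\<in>S. \<forall>p\<in>set fs. u < 2 * W \<longrightarrow> 0 \<le> shift W p u \<longrightarrow> nat (shift W p u) \<in> S')"
proof -
  define pos where "pos k = length pre + length (concat (map enc_fun (take k fs)))" for k
  have lw: "length pre \<le> length w" "length fs \<le> length w"
    using length_concat_enc[of fs] by (auto simp: w)
  define I where "I i s' S' \<longleftrightarrow> s' = s(Pos := pos (min i (length fs)), L2 := length w - i) \<and> S \<subseteq> S' \<and> S' \<subseteq> G
    \<and> (\<forall>u\<in>S. \<forall>p\<in>set (take i fs). u < 2 * W \<longrightarrow> 0 \<le> shift W p u \<longrightarrow> nat (shift W p u) \<in> S')" for i s' S'
  let ?body = "IfTr In0 Pos Step (IfTr In1 Pos Step Skip)"
  have "\<exists>s' S'. exec w P (Rep L2 ?body) (s(Pos := length pre, L2 := length w)) S s' S'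
    \<and> I (length w) s' S' \<and> s' L2 = 0"
  proof (rule exec_Rep_inv)
    show "I 0 (s(Pos := length pre, L2 := length w)) S" using s G by (auto simp: I_def fun_eq_iff pos_def)
  next
    fix i s1 S1
    assume i: "i < length w" and I: "I i s1 S1"
    define s2 where "s2 = s1(L2 := length w - Suc i)"
    have p2: "s2 Pos = pos (min i (length fs))" using I by (auto simp: I_def s2_def)
    have "\<exists>s' S'. exec w P ?body s2 S1 s' S' \<and> s' L2 = length w - Suc i \<and> I (Suc i) s' S'"
    proof (cases "i < length fs")
      case False
      then have "s2 Pos = length w" using p2 by (simp add: pos_def w)
      then have "exec w P ?body s2 S1 s2 S1"
        by (intro exec_IfTrF) (auto intro: exec_Skip)
      moreover have "I (Suc i) s2 S1" "s2 L2 = length w - Suc i" using I False by (auto simp: I_def s2_def)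
      ultimately show ?thesis by blast
    next
      case True
      obtain a b where ab: "fs ! i = (a, b)" by fastforce
      define pre' where "pre' = pre @ concat (map enc_fun (take i fs))"
      have "fs = take i fs @ (a, b) # drop (Suc i) fs" using True ab id_take_nth_drop by metis
      then have "concat (map enc_fun fs) = concat (map enc_fun (take i fs @ (a, b) # drop (Suc i) fs))" by simp
      then have w': "w = pre' @ (enc_int a @ enc_int b) @ concat (map enc_fun (drop (Suc i) fs))"
        by (simp add: w pre'_def)
      have pos: "s2 Pos = length pre'" "pos (Suc i) = length pre' + length (enc_int a @ enc_int b)"
        using p2 True ab by (auto simp: pos_def pre'_def take_Suc_conv_app_nth)
      have id: "idle s2" using I s(1) by (auto simp: I_def s2_def idle_def)
      have "(a, b) \<in> set fs" using True ab nth_mem by metis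
      then have G': "u \<in> G \<Longrightarrow> 0 \<le> shift W (a, b) u \<Longrightarrow> nat (shift W (a, b) u) \<in> G" for u
        using G(1) by blast
      have "S1 \<subseteq> G" using I by (simp add: I_def)
      from exec_Step[OF w' id pos(1) G' this] obtain S2 where
        S2: "exec w P Step s2 S1 (s2(Pos := pos (Suc i))) S2" "S1 \<subseteq> S2" "S2 \<subseteq> G"
        "\<forall>u\<in>S1. u < 2 * W \<longrightarrow> 0 \<le> shift W (a, b) u \<longrightarrow> nat (shift W (a, b) u) \<in> S2"
        unfolding pos(2)[symmetric] by blast
      have "length pre' < length w" by (subst w') simp
      then have "s2 Pos < length w" using pos(1) by simp
      then have "exec w P ?body s2 S1 (s2(Pos := pos (Suc i))) S2"
      proof (cases "w ! s2 Pos")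
        case True
        with S2(1) \<open>s2 Pos < length w\<close> show ?thesis by (intro exec_IfTrF exec_IfTrT) auto
      next
        case False
        with S2(1) \<open>s2 Pos < length w\<close> show ?thesis by (intro exec_IfTrT) auto
      qed
      moreover have "I (Suc i) (s2(Pos := pos (Suc i))) S2"
        using I S2 True ab by (auto simp: I_def s2_def take_Suc_conv_app_nth fun_eq_iff)
      moreover have "(s2(Pos := pos (Suc i))) L2 = length w - Suc i" by (simp add: s2_def)
      ultimately show ?thesis by blast
    qed
    then show "\<exists>s' S'. exec w P ?body (s1(L2 := length w - Suc i)) S1 s' S' \<and> s' L2 = length w - Suc i \<and> I (Suc i) s' S'"
      by (simp only: s2_def)
  qed simp
  then obtain s' S' where *: "exec w P (Rep L2 ?body) (s(Pos := length pre, L2 := length w)) S s' S'"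
    "I (length w) s' S'" by blast
  have 1: "exec w P (Add Pos Pos0) s S (s(Pos := length pre)) S"
    by (rule exec_cong[OF exec_Add]) (use s lw P_bounds in \<open>auto simp: idle_def\<close>)
  have 2: "exec w P (For L2 N ?body) (s(Pos := length pre)) S s' S'"
    by (rule exec_For) (use s P_bounds * in \<open>auto simp: idle_def\<close>)
  have "exec w P Round s S s S'"
    unfolding Round_def
    by (rule exec_cong[OF exec_Seq[OF 1 exec_Seq[OF 2 exec_Clr]]]) (use *(2) s in \<open>auto simp: I_def fun_eq_iff\<close>)
  moreover have "take (length w) fs = fs" using lw by simp
  ultimately show ?thesis using *(2) by (auto simp: I_def)
qed

end

section \<open>The complete program\<close>

definition Dup8 :: "var \<Rightarrow> cmd" where
  "Dup8 x = Dup x ;; Dup x ;; Dup x ;; Dup x ;; Dup x ;; Dup x ;; Dup x ;; Dup x"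

text \<open>Multiplying \<open>Pw\<close> by 2 ^ 8 once per input bit yields 2 ^ (8 n), and doubling
  \<open>V\<close> that many times yields the window size of
  \<open>reach_win_relpow\<close>.\<close>

definition Setup :: cmd where
  "Setup = Inc Pw ;; For L1 N (Dup8 Pw) ;; Inc V ;; Rep Pw (Dup V) ;; Add VV V ;; Add VV V"

text \<open>Turns a parsed integer into its array index; truncated subtraction is exact here as long
  as the absolute value is at most the content of \<open>V\<close>.\<close>

definition Load :: "var \<Rightarrow> var \<Rightarrow> var \<Rightarrow> cmd" where
  "Load sg v x = Add x V ;; IfZ sg (Add x v) (Sub x v) ;; Clr v ;; Clr sg"

text \<open>The array entry \<^term>\<open>u\<close> stands for the value \<^term>\<open>int u - int W\<close>, where \<^term>\<open>W\<close> is the content of \<^term>\<open>V\<close>;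
  \<^term>\<open>Ans\<close> is left at 0 for acceptance.\<close>
definition Reach :: cmd where
  "Reach = Setup ;; Parse SA AA ;; Load SA AA UU ;; SetS UU ;; Clr UU ;; Parse SB BB ;; Load SB BB YY ;;
     Add Pos0 Pos ;; Clr Pos ;; For L1 V Round ;; IfTr Arr YY Skip (Inc Ans)"

lemma exec_Dup8:
  assumes "x \<noteq> Tmp" "x \<noteq> Dbl" "s Tmp = 0" "s Dbl = 0" "2 ^ 8 * s x \<le> P"
  shows "exec w P (Dup8 x) s S (s(x := 2 ^ 8 * s x)) S"
  unfolding Dup8_def
  by (rule exec_cong[OF exec_Seq[OF exec_Dup exec_Seq[OF exec_Dup exec_Seq[OF exec_Dup exec_Seq[OF exec_Dup
      exec_Seq[OF exec_Dup exec_Seq[OF exec_Dup exec_Seq[OF exec_Dup exec_Dup]]]]]]]])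
    (use assms in \<open>auto simp: fun_eq_iff\<close>)

lemma exec_Setup:
  assumes "W = 2 ^ 2 ^ (8 * length w)" "2 * W \<le> P"
  shows "exec w P Setup ((\<lambda>_. 0)(N := length w)) S ((\<lambda>_. 0)(N := length w, V := W, VV := 2 * W)) S"
proof -
  define n E where "n = length w" and "E = (2::nat) ^ (8 * n)"
  have EW: "E < W" "W = 2 ^ E" using assms(1) less_exp[of E] by (simp_all add: E_def n_def)
  have nE: "n \<le> E" 
  proof -
    have "n < 2 ^ n" by (rule less_exp)
    also have "\<dots> \<le> E" unfolding E_def by (rule power_increasing) auto
    finally show ?thesis by simp
  qed
  have nP: "n \<le> P" "0 < P" using nE EW(1) assms(2) by linarith+
  define s0 :: "var \<Rightarrow> nat" where "s0 = (\<lambda>_. 0)(N := n)"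
  have 1: "exec w P (Inc Pw) s0 S (s0(Pw := 1)) S"
    by (rule exec_Inc) (use nP(2) in \<open>auto simp: s0_def\<close>)
  have 2: "exec w P (For L1 N (Dup8 Pw)) (s0(Pw := 1)) S (s0(Pw := E)) S"
  proof (rule exec_For)
    define f where "f i = s0(Pw := 2 ^ (8 * i), L1 := n - i)" for i
    show "exec w P (Rep L1 (Dup8 Pw)) (s0(Pw := 1, L1 := (s0(Pw := 1)) N)) S (s0(Pw := E)) S"
    proof (rule exec_Rep_det[of _ f _ n])
      fix i assume "i < n"
      then have "(2::nat) ^ (8 * Suc i) \<le> E" unfolding E_def by (intro power_increasing) auto
      moreover have "(2::nat) ^ (8 * Suc i) = 2 ^ 8 * 2 ^ (8 * i)" by (simp add: power_add)
      ultimately have *: "2 ^ 8 * 2 ^ (8 * i) \<le> P" using EW(1) assms(2) by linarith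
      show "exec w P (Dup8 Pw) ((f i)(L1 := n - Suc i)) S (f (Suc i)) S"
        by (rule exec_cong[OF exec_Dup8]) (use * in \<open>auto simp: f_def s0_def fun_eq_iff power_add\<close>)
    qed (auto simp: f_def s0_def fun_eq_iff E_def)
  qed (use nP in \<open>auto simp: s0_def\<close>)
  have 3: "exec w P (Inc V) (s0(Pw := E)) S (s0(Pw := E, V := 1)) S"
    by (rule exec_Inc) (use nP(2) in \<open>auto simp: s0_def\<close>)
  have 4: "exec w P (Rep Pw (Dup V)) (s0(Pw := E, V := 1)) S (s0(V := W)) S"
  proof -
    define f where "f i = s0(V := 2 ^ i, Pw := E - i)" for i
    show ?thesis
    proof (rule exec_Rep_det[of _ f _ E])
      fix i assume "i < E"
      then have "(2::nat) ^ Suc i \<le> W" unfolding EW(2) by (intro power_increasing) auto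
      then have *: "2 * 2 ^ i \<le> P" using assms(2) by simp
      show "exec w P (Dup V) ((f i)(Pw := E - Suc i)) S (f (Suc i)) S"
        by (rule exec_cong[OF exec_Dup]) (use * in \<open>auto simp: f_def s0_def fun_eq_iff\<close>)
    qed (auto simp: f_def s0_def fun_eq_iff EW(2))
  qed
  have 5: "exec w P (Add VV V) (s0(V := W)) S (s0(V := W, VV := W)) S"
    by (rule exec_cong[OF exec_Add]) (use assms(2) in \<open>auto simp: s0_def fun_eq_iff\<close>)
  have 6: "exec w P (Add VV V) (s0(V := W, VV := W)) S (s0(V := W, VV := 2 * W)) S"
    by (rule exec_cong[OF exec_Add]) (use assms(2) in \<open>auto simp: s0_def fun_eq_iff\<close>)
  show ?thesis unfolding Setup_def n_def[symmetric] s0_def[symmetric]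
    by (intro exec_Seq[OF 1] exec_Seq[OF 2] exec_Seq[OF 3] exec_Seq[OF 4] exec_Seq[OF 5] 6)
qed

lemma exec_Load:
  assumes "distinct [sg, v, x, V, Tmp]" "s sg = of_bool (z < 0)" "s v = nat \<bar>z\<bar>" "s x = 0" "s Tmp = 0"
    "s V = W" "nat \<bar>z\<bar> \<le> W" "2 * W \<le> P"
  shows "exec w P (Load sg v x) s S (s(x := nat (z + int W), v := 0, sg := 0)) S"
proof -
  have 1: "exec w P (Add x V) s S (s(x := W)) S"
    by (rule exec_cong[OF exec_Add]) (use assms in auto)
  have 2: "\<exists>k. exec w P (IfZ sg (Add x v) (Sub x v)) (s(x := W)) S (s(x := nat (z + int W), v := k)) S"
  proof (cases "z < 0")
    case True
    have "exec w P (Sub x v) (s(x := W)) S (s(x := nat (z + int W), v := 0)) S"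
      by (rule exec_cong[OF exec_Sub]) (use assms True in \<open>auto simp: fun_eq_iff\<close>)
    then show ?thesis using True assms by (intro exI[of _ 0] exec_IfZF) auto
  next
    case False
    have "exec w P (Add x v) (s(x := W)) S (s(x := nat (z + int W), v := nat \<bar>z\<bar>)) S"
      by (rule exec_cong[OF exec_Add]) (use assms False in \<open>auto simp: fun_eq_iff nat_add_distrib\<close>)
    then show ?thesis using False assms by (intro exI[of _ "nat \<bar>z\<bar>"] exec_IfZT) auto
  qed
  then obtain k where 2: "exec w P (IfZ sg (Add x v) (Sub x v)) (s(x := W)) S (s(x := nat (z + int W), v := k)) S" ..
  show ?thesis unfolding Load_def
    by (rule exec_cong[OF exec_Seq[OF 1 exec_Seq[OF 2 exec_Seq[OF exec_Clr exec_Clr]]]]) (use assms in \<open>auto simp: fun_eq_iff\<close>)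
qed

text \<open>Soundness holds because marked indices never leave the closed set \<open>G\<close> of
  reachable values. For completeness, i rounds mark every value that the window allows to reach in
  at most i steps, and by \<open>complete\<close> the W rounds performed are enough.\<close>

lemma exec_Reach:
  assumes w: "w = enc_inst x y fs" and W: "W = 2 ^ 2 ^ (8 * length w)"
    and P: "2 ^ length w * (3 * W + 1) + W + 1 \<le> P"
    and complete: "reach (set fs) x y \<Longrightarrow> \<exists>k\<le>W. (x, y) \<in> win (set fs) (int W) ^^ k"
  shows "\<exists>s S. exec w P Reach ((\<lambda>_. 0)(N := length w)) {} s S \<and> (s Ans = 0 \<longleftrightarrow> reach (set fs) x y)"
proof -
  interpret window w P W by unfold_locales (rule P)
  define s0 :: "var \<Rightarrow> nat" where "s0 = (\<lambda>_. 0)(N := length w, V := W, VV := 2 * W)"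
  define pre where "pre = enc_int x @ enc_int y"
  have wx: "w = [] @ enc_int x @ (enc_int y @ concat (map enc_fun fs))"
    and wy: "w = enc_int x @ enc_int y @ concat (map enc_fun fs)"
    and wf: "w = pre @ concat (map enc_fun fs)"
    by (simp_all add: w enc_inst_def pre_def)
  have small: "nat \<bar>z\<bar> < W" if "z \<in> {x, y}" for z
  proof -
    have "nat \<bar>z\<bar> < 2 ^ length (enc_int z)" by (rule nat_less_power_enc)
    also have "\<dots> \<le> 2 ^ 2 ^ (8 * length w)"
    proof (rule power_increasing)
      have "length (enc_int z) \<le> length w" using that wy by auto
      also have "\<dots> < 2 ^ length w" by (rule less_exp)
      also have "\<dots> \<le> 2 ^ (8 * length w)" by (rule power_increasing) auto
      finally show "length (enc_int z) \<le> 2 ^ (8 * length w)" by simp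
    qed simp
    finally show ?thesis by (simp add: W)
  qed
  define ix where "ix z = nat (z + int W)" for z
  \<comment> \<open>Values beyond the window are included: \<open>Body\<close> may mark an index of
    2W or more, which is harmless as its value is reachable.\<close>
  define G where "G = {u. reach (set fs) x (int u - int W)}"
  have G: "nat (shift W p u) \<in> G" if "u \<in> G" "p \<in> set fs" "0 \<le> shift W p u" for u p
    using reach_step[of "set fs" x "int u - int W" p] that by (simp add: G_def shift_def)
  have xG: "{ix x} \<subseteq> G" using small[of x] by (auto simp: G_def ix_def reach_refl)
  have 1: "exec w P Setup ((\<lambda>_. 0)(N := length w)) {} s0 {}"
    unfolding s0_def by (rule exec_Setup) (use W P_bounds in auto)
  have 2: "exec w P (Parse SA AA) s0 {} (s0(SA := of_bool (x < 0), AA := nat \<bar>x\<bar>, Pos := length (enc_int x))) {}"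
    by (rule exec_cong[OF exec_Parse[OF wx P_bounds(1)]]) (auto simp: s0_def)
  have 3: "exec w P (Load SA AA UU) (s0(SA := of_bool (x < 0), AA := nat \<bar>x\<bar>, Pos := length (enc_int x))) {}
      (s0(Pos := length (enc_int x), UU := ix x)) {}"
    by (rule exec_cong[OF exec_Load[of _ _ _ _ x W]]) (use small[of x] P_bounds in \<open>auto simp: s0_def ix_def fun_eq_iff\<close>)
  have 4: "exec w P (SetS UU) (s0(Pos := length (enc_int x), UU := ix x)) {} (s0(Pos := length (enc_int x), UU := ix x)) {ix x}"
    by (rule exec_SetS) simp
  have 5: "exec w P (Clr UU) (s0(Pos := length (enc_int x), UU := ix x)) {ix x} (s0(Pos := length (enc_int x))) {ix x}"
    by (rule exec_cong[OF exec_Clr]) (auto simp: s0_def fun_eq_iff)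
  have 6: "exec w P (Parse SB BB) (s0(Pos := length (enc_int x))) {ix x}
      (s0(SB := of_bool (y < 0), BB := nat \<bar>y\<bar>, Pos := length pre)) {ix x}"
    by (rule exec_cong[OF exec_Parse[OF wy P_bounds(1)]]) (auto simp: s0_def pre_def fun_eq_iff)
  have 7: "exec w P (Load SB BB YY) (s0(SB := of_bool (y < 0), BB := nat \<bar>y\<bar>, Pos := length pre)) {ix x}
      (s0(Pos := length pre, YY := ix y)) {ix x}"
    by (rule exec_cong[OF exec_Load[of _ _ _ _ y W]]) (use small[of y] P_bounds in \<open>auto simp: s0_def ix_def fun_eq_iff\<close>)
  define s1 where "s1 = s0(YY := ix y, Pos0 := length pre)"
  have "length pre \<le> length w" by (simp add: wf)
  then have 8: "exec w P (Add Pos0 Pos) (s0(Pos := length pre, YY := ix y)) {ix x} (s1(Pos := length pre)) {ix x}"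
    by (intro exec_cong[OF exec_Add]) (use P_bounds in \<open>auto simp: s1_def s0_def fun_eq_iff\<close>)
  have 9: "exec w P (Clr Pos) (s1(Pos := length pre)) {ix x} s1 {ix x}"
    by (rule exec_cong[OF exec_Clr]) (auto simp: s1_def s0_def fun_eq_iff)
  define I where "I i s' S' \<longleftrightarrow> s' = s1(L1 := W - i) \<and> S' \<subseteq> G
    \<and> (\<forall>j\<le>i. \<forall>z. (x, z) \<in> win (set fs) (int W) ^^ j \<longrightarrow> ix z \<in> S')" for i s' S'
  have "\<exists>s' S'. exec w P (Rep L1 Round) (s1(L1 := W)) {ix x} s' S' \<and> I W s' S' \<and> s' L1 = 0"
  proof (rule exec_Rep_inv)
    show "I 0 (s1(L1 := W)) {ix x}" using xG by (auto simp: I_def)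
  next
    fix i s' S'
    assume i: "i < W" and I: "I i s' S'"
    define s2 where "s2 = s1(L1 := W - Suc i)"
    have s2: "s'(L1 := W - Suc i) = s2" using I by (simp add: I_def s2_def)
    have "idle s2" "s2 Pos = 0" "s2 Pos0 = length pre" "s2 L2 = 0"
      by (simp_all add: idle_def s2_def s1_def s0_def)
    moreover have "S' \<subseteq> G" using I by (simp add: I_def)
    ultimately obtain S'' where S'': "exec w P Round s2 S' s2 S''" "S' \<subseteq> S''" "S'' \<subseteq> G"
      "\<forall>u\<in>S'. \<forall>p\<in>set fs. u < 2 * W \<longrightarrow> 0 \<le> shift W p u \<longrightarrow> nat (shift W p u) \<in> S''"
      using exec_Round[OF wf, of s2 G S'] G by blast
    have "ix z \<in> S''" if jz: "j \<le> Suc i" "(x, z) \<in> win (set fs) (int W) ^^ j" for j z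
    proof (cases "j \<le> i")
      case True
      then show ?thesis using I S''(2) jz by (auto simp: I_def)
    next
      case False
      with jz(1) have j: "j = Suc i" by simp
      have "(x, z) \<in> win (set fs) (int W) ^^ Suc i" using jz(2) unfolding j .
      then obtain z' where z': "(x, z') \<in> win (set fs) (int W) ^^ i" "(z', z) \<in> win (set fs) (int W)"
        by (rule relpow_Suc_E)
      then obtain p where p: "p \<in> set fs" "z = aff p z'" "\<bar>z'\<bar> < int W" "\<bar>z\<bar> < int W"
        by (auto simp: win_def)
      have a: "ix z' \<in> S'" using z'(1) I by (auto simp: I_def)
      have b: "ix z' < 2 * W" "int (ix z') - int W = z'" using p by (auto simp: ix_def)
      have c: "shift W p (ix z') = z + int W" using p b(2) by (simp add: shift_def)
      then have "0 \<le> shift W p (ix z')" using p(4) by linarith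
      then have "nat (shift W p (ix z')) \<in> S''" using S''(4) a b(1) p(1) by blast
      then show ?thesis unfolding c by (simp only: ix_def)
    qed
    then have "I (Suc i) s2 S''" using S'' by (auto simp: I_def s2_def)
    then show "\<exists>s'' S''. exec w P Round (s'(L1 := W - Suc i)) S' s'' S'' \<and> s'' L1 = W - Suc i \<and> I (Suc i) s'' S''"
      unfolding s2 using S''(1) by (intro exI[of _ s2] exI[of _ S'']) (simp add: s2_def)
  qed simp
  then obtain s' S' where *: "exec w P (Rep L1 Round) (s1(L1 := W)) {ix x} s' S'" "I W s' S'" by blast
  have 10: "exec w P (For L1 V Round) s1 {ix x} s' S'"
    by (rule exec_For) (use P_bounds * in \<open>auto simp: s1_def s0_def\<close>)
  have s': "s' = s1" using * by (auto simp: I_def s1_def s0_def)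
  define s2 where "s2 = (if ix y \<in> S' then s1 else s1(Ans := 1))"
  have 11: "exec w P (IfTr Arr YY Skip (Inc Ans)) s' S' s2 S'"
  proof (cases "ix y \<in> S'")
    case True
    then show ?thesis unfolding s' s2_def by (intro exec_IfTrT) (auto simp: s1_def intro: exec_Skip)
  next
    case False
    have "exec w P (Inc Ans) s1 S' s2 S'"
      by (rule exec_Inc) (use False P_bounds in \<open>auto simp: s1_def s0_def s2_def\<close>)
    then show ?thesis unfolding s' using False by (intro exec_IfTrF) (auto simp: s1_def)
  qed
  have ans: "s2 Ans = 0 \<longleftrightarrow> reach (set fs) x y"
  proof -
    have "s2 Ans = 0 \<longleftrightarrow> ix y \<in> S'" by (simp add: s2_def s1_def s0_def)
    also have "\<dots> \<longleftrightarrow> reach (set fs) x y"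
    proof
      assume "ix y \<in> S'"
      then have "ix y \<in> G" using *(2) by (auto simp: I_def)
      moreover have "int (ix y) - int W = y" using small[of y] by (auto simp: ix_def)
      ultimately show "reach (set fs) x y" by (simp add: G_def)
    next
      assume "reach (set fs) x y"
      from complete[OF this] show "ix y \<in> S'" using *(2) by (auto simp: I_def)
    qed
    finally show ?thesis .
  qed
  have "exec w P Reach ((\<lambda>_. 0)(N := length w)) {} s2 S'"
    unfolding Reach_def
    by (intro exec_Seq[OF 1] exec_Seq[OF 2] exec_Seq[OF 3] exec_Seq[OF 4] exec_Seq[OF 5] exec_Seq[OF 6]
      exec_Seq[OF 7] exec_Seq[OF 8] exec_Seq[OF 9] exec_Seq[OF 10] 11)
  with ans show ?thesis by (intro exI conjI)
qed

lemma answers_within_mono: "answers_within M w T b \<Longrightarrow> T \<le> T' \<Longrightarrow> answers_within M w T' b"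
  unfolding answers_within_def by (meson order.trans)

text \<open>\<open>6 * P + 10\<close> is at most 2 ^ 2 ^ (8 n + 1), and the power k multiplies the
  inner exponent by k < 2 ^ k. As n + 1 \<ge> 2, the resulting 8 n + 1 + k is absorbed by a power of
  n + 1 whose degree depends on k only.\<close>

lemma time_bound:
  assumes "1 \<le> n" and W: "W = 2 ^ 2 ^ (8 * n)" and P: "P = 2 ^ n * (3 * W + 1) + W + 1"
  shows "(6 * P + 10) ^ k \<le> (2::nat) ^ 2 ^ ((n + 1) ^ (k + 9))"
proof -
  have W1: "1 \<le> W" by (simp add: W)
  have nW: "1 \<le> 2 ^ n * W" using W1 by simp
  have "W \<le> 2 ^ n * W" by simp
  have "2 ^ n * 1 \<le> 2 ^ n * W" using W1 by (rule mult_le_mono2)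
  then have "P \<le> 3 * (2 ^ n * W) + 2 ^ n * W + 2 ^ n * W + 2 ^ n * W"
  proof -
    have "P = 3 * (2 ^ n * W) + 2 ^ n + W + 1" unfolding P by (simp add: algebra_simps)
    with \<open>2 ^ n * 1 \<le> 2 ^ n * W\<close> \<open>W \<le> 2 ^ n * W\<close> nW show ?thesis by linarith
  qed
  then have "6 * P + 10 \<le> 64 * (2 ^ n * W)" using nW by linarith
  also have "\<dots> = 2 ^ (6 + n + 2 ^ (8 * n))" by (simp add: W power_add)
  also have "\<dots> \<le> 2 ^ 2 ^ (8 * n + 1)"
  proof (rule power_increasing)
    have "6 + n \<le> 8 * n" using assms(1) by simp
    also have "\<dots> < 2 ^ (8 * n)" by (rule less_exp)
    finally show "6 + n + 2 ^ (8 * n) \<le> 2 ^ (8 * n + 1)" by simp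
  qed simp
  finally have "(6 * P + 10) ^ k \<le> (2 ^ 2 ^ (8 * n + 1)) ^ k" by (rule power_mono) simp
  also have "\<dots> = 2 ^ (2 ^ (8 * n + 1) * k)" by (rule power_mult[symmetric])
  also have "\<dots> \<le> 2 ^ 2 ^ ((n + 1) ^ (k + 9))"
  proof (rule power_increasing)
    have "2 ^ (8 * n + 1) * k \<le> 2 ^ (8 * n + 1) * 2 ^ k"
      using less_exp[of k] by (intro mult_le_mono2) simp
    also have "\<dots> = 2 ^ (8 * n + 1 + k)" by (rule power_add[symmetric])
    also have "\<dots> \<le> 2 ^ ((n + 1) ^ (k + 9))"
    proof (rule power_increasing)
      have "8 * n + 1 + k \<le> (n + 1) * (k + 8)" by (simp add: algebra_simps)
      also have "\<dots> \<le> (n + 1) * 2 ^ (k + 8)" using less_exp[of "k + 8"] by (intro mult_le_mono2) simp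
      also have "\<dots> \<le> (n + 1) * (n + 1) ^ (k + 8)" using assms(1) by (intro mult_le_mono2 power_mono) auto
      also have "\<dots> = (n + 1) ^ (k + 9)" by (simp add: numeral_eq_Suc)
      finally show "8 * n + 1 + k \<le> (n + 1) ^ (k + 9)" .
    qed simp
    finally show "2 ^ (8 * n + 1) * k \<le> 2 ^ ((n + 1) ^ (k + 9))" .
  qed simp
  finally show ?thesis .
qed

lemma enc_int_bound:
  assumes "length (enc_int z) \<le> n" shows "\<bar>z\<bar> \<le> 2 ^ n"
proof -
  have "nat \<bar>z\<bar> < 2 ^ length (enc_int z)" by (rule nat_less_power_enc)
  also have "\<dots> \<le> 2 ^ n" using assms by (intro power_increasing) auto
  finally have "int (nat \<bar>z\<bar>) < int (2 ^ n)" by (simp only: of_nat_less_iff)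
  then show ?thesis by simp
qed

text \<open>One fixed program treats all inputs, so \<open>csize Reach\<close> is a constant and the
  witness for \<open>c\<close>, which is \<open>csize Reach + 2 + 9\<close>, does not depend on the
  instance.\<close>

theorem mainTheorem8:
  shows "\<exists>M c. wf_tm M \<and>
     (\<forall>x y fs. answers_within M (enc_inst x y fs)
                 (2 ^ (2 ^ ((length (enc_inst x y fs) + 1) ^ c)))
                 (reach (set fs) x y))"
proof (intro exI conjI allI)
  let ?k = "csize Reach + 2"
  show "wf_tm (decider (TSeq preamble (compile Reach)) (pebble Ans))"
    unfolding decider_def by (rule wf_machine)
  fix x y fs
  define w where "w = enc_inst x y fs"
  define n where "n = length w"
  define W :: nat where "W = 2 ^ 2 ^ (8 * n)"
  define P where "P = 2 ^ n * (3 * W + 1) + W + 1"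
  have len: "length (enc_int x) \<le> n" "length (enc_int y) \<le> n" "2 \<le> n"
    unfolding n_def w_def enc_inst_def by (auto simp: enc_int_def length_sd)
  have lenf: "length (enc_int (fst p)) \<le> n \<and> length (enc_int (snd p)) \<le> n" if "p \<in> set fs" for p
  proof -
    from split_list[OF that] obtain us vs where "fs = us @ p # vs" by blast
    then show ?thesis unfolding n_def w_def enc_inst_def by (cases p) auto
  qed
  have complete: "\<exists>k\<le>W. (x, y) \<in> win (set fs) (int W) ^^ k" if "reach (set fs) x y"
    unfolding W_def
    by (rule reach_win_relpow[OF len(3) _ enc_int_bound[OF len(1)] enc_int_bound[OF len(2)] that])
      (use lenf enc_int_bound in blast)
  have "2 ^ length w * (3 * W + 1) + W + 1 \<le> P" by (simp add: P_def n_def)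
  then have "\<exists>s S. exec w P Reach ((\<lambda>_. 0)(N := length w)) {} s S \<and> (s Ans = 0 \<longleftrightarrow> reach (set fs) x y)"
    by (rule exec_Reach[OF w_def W_def[unfolded n_def]]) (rule complete)
  then obtain s S where
    s: "exec w P Reach ((\<lambda>_. 0)(N := length w)) {} s S" "s Ans = 0 \<longleftrightarrow> reach (set fs) x y"
    by (elim exE conjE)
  have "n < P"
  proof -
    have "n < 2 ^ n * 1" using less_exp[of n] by simp
    also have "\<dots> \<le> 2 ^ n * (3 * W + 1)" by (rule mult_le_mono2) simp
    finally show ?thesis unfolding P_def by linarith
  qed
  then have "answers_within (decider (TSeq preamble (compile Reach)) (pebble Ans)) w ((6 * P + 10) ^ ?k) (s Ans = 0)"
    by (intro exec_decider[OF s(1)]) (simp add: n_def)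
  moreover have "(6 * P + 10) ^ ?k \<le> 2 ^ 2 ^ ((n + 1) ^ (?k + 9))"
    by (rule time_bound[OF _ W_def P_def]) (use len in simp)
  ultimately show "answers_within (decider (TSeq preamble (compile Reach)) (pebble Ans)) (enc_inst x y fs)
      (2 ^ 2 ^ ((length (enc_inst x y fs) + 1) ^ (?k + 9))) (reach (set fs) x y)"
    unfolding s(2) w_def[symmetric] n_def[symmetric] by (rule answers_within_mono)
qed

end
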